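(* Assume $\mathcal R_\Theta=\{r_\theta:\theta\in\Theta\}$, $\Theta\subset\mathbb R^d$, is finite and realizable (there is $\theta^*\in\Theta$ with $r_{\theta^*}=r^*$), that $\pi_0(a|x)>0$ for all $x,a$, and that $f'$ is invertible with $0\notin\mathrm{dom}(f')$. Let $C\ge1$ be a constant such that for all $\theta\in\Theta$, $x\in\mathcal X$, $a^1,a^2\in\mathcal A$, $$\sigma(r_\theta(x,a^1)-r_\theta(x,a^2))\,\sigma(r_\theta(x,a^2)-r_\theta(x,a^1))\le C\,\sigma(r^*(x,a^1)-r^*(x,a^2))\,\sigma(r^*(x,a^2)-r^*(x,a^1)).$$ Let $\hat\pi=\pi_{\theta_T}$ be the output after $T$ rounds of the derivative-based exploration algorithm described in the context. Then for every $\varepsilon>0$, $$\limsup_{T\to\infty}\mathbb P\Big(J_f(\pi_f^* )-J_f(\hat\pi)\ge C_0\frac{d(1+\varepsilon)}{T}\Big)\le\mathbb P\big(\chi_d^2\ge d(1+\varepsilon)\big)\le\exp\Big(-\frac d2\big(\varepsilon-\log(1+\varepsilon)\big)\Big),$$ where $\chi^2_d$ is a chi-squared random variable with $d$ degrees of freedom, $C_0=2\eta\,C\,\mathcal M(f,\mathcal R_\Theta,\eta)\,\big\|\overline T_{\theta^*}+\overline T_{\theta^*}Z^+_{\theta^*}Z^-_{\theta^*}\big\|_\infty$ (supremum norm over $x\in\mathcal X$), and, with $\overline{\mathcal R_\Theta}$ the convex hull of $\mathcal R_\Theta$, $$\mathcal M(f,\mathcal R_\Theta,\eta)=\max_{r\in\overline{\mathcal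 R_\Theta}}\max_x\sum_{a\in\mathcal A}\pi_0(a|x)\,h'\big(\eta(r(x,a)-\lambda_r(x))\big).$$
   Context: **Setting.** $\mathcal X$ is a set of contexts with distribution $\rho$; $\mathcal A$ is a finite set of actions; a policy $\pi$ gives a distribution $\pi(\cdot|x)$ on $\mathcal A$ for each $x$; $\pi_0$ is a reference policy; $\eta>0$. $r^*:\mathcal X\times\mathcal A\to[0,1]$ is the unknown true reward and all $r_\theta$ map $\mathcal X\times\mathcal A$ to $[0,1]$. Bradley–Terry preferences: given $(x,a^1,a^2)$, $a^1$ is preferred to $a^2$ with probability $\sigma(r^*(x,a^1)-r^*(x,a^2))$, $\sigma(u)=1/(1+e^{-u})$, independently of the past given $(x,a^1,a^2)$; $a^\omega$ and $a^l$ denote the preferred and the non-preferred action of the pair. **Objective.** $f:(0,\infty)\to\mathbb R$ is convex, strictly convex around $1$, $f(1)=0$, twice continuously differentiable with $f''>0$; "$0\notin\mathrm{dom}(f')$" means $\lim_{u\to0^+}f'(u)=-\infty$; $h:=(f')^{-1}$. $D_f(\pi,\pi_0|x)=\sum_a\pi_0(a|x)f(\pi(a|x)/\pi_0(a|x))$, $J_f(\pi)=\mathbb E_{x\sim\rho}\big[\mathbb E_{a\sim\pi(\cdot|x)}[r^*(x,a)]-\eta^{-1}D_f(\pi,\pi_0|x)\big]$, $\pi_f^*=\arg\max_\pi J_f(\pi)$. For a reward function $r$, $\pi_r(a|x)=\pi_0(a|x)h(\eta(r(x,a)-\lambda_r(x)))$ with $\lambda_r(x)$ determined by $\sum_a\pi_0(a|x)h(\eta(r(x,a)-\lambda_r(x)))=1$;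 $\pi_\theta:=\pi_{r_\theta}$, $\lambda_\theta:=\lambda_{r_\theta}$. **Sampling policies.** $\overline T_\theta(x)=\sum_a\pi_0(a|x)h'(\eta(r_\theta(x,a)-\lambda_\theta(x)))$, $\pi'_\theta(a|x)=\pi_0(a|x)h'(\eta(r_\theta(x,a)-\lambda_\theta(x)))/\overline T_\theta(x)$, $Z^\pm_\theta(x)=\sum_a\pi'_\theta(a|x)\exp(\pm r_\theta(x,a))$, $\pi^\pm_\theta(a|x)=\pi'_\theta(a|x)\exp(\pm r_\theta(x,a))/Z^\pm_\theta(x)$, $p_\theta(x)=Z^+_\theta(x)Z^-_\theta(x)/(1+Z^+_\theta(x)Z^-_\theta(x))$, and the weight $\omega_\theta(x)=\{\overline T_\theta(x)+Z^+_\theta(x)Z^-_\theta(x)\overline T_\theta(x)\}/\overline Z_\theta$ with $\overline Z_\theta=\mathbb E_{x\sim\rho}[\overline T_\theta(x)+Z^+_\theta(x)Z^-_\theta(x)\overline T_\theta(x)]$. **Algorithm.** Start from some $\theta_0\in\Theta$. In round $t=1,\dots,T$, with current parameter $\theta=\theta_{t-1}$: sample $x_t\sim\rho$; with probability $1-p_\theta(x_t)$ sample $a_t^1,a_t^2\sim\pi'_\theta(\cdot|x_t)$ independently, and with probability $p_\theta(x_t)$ sample $a_t^1\sim\pi_\theta^+(\cdot|x_t)$, $a_t^2\sim\pi_\theta^-(\cdot|x_t)$ independently; observe the preference; compute $$\theta_t\in\arg\min_{\vartheta\in\Theta}\ -\frac1t\sum_{i=1}^t\omega(x_i)\log\sigma\big(r_\vartheta(x_i,a_i^\omega)-r_\vartheta(x_i,a_i^l)\big),$$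 where $\omega=\omega_\theta$ is the weight at the sampling parameter (not optimized over). *)

theory Defs
  imports "HOL-Probability.Probability"
begin

text \<open>
  Contexts form the type \<open>'x\<close>, carrying the distribution \<open>\<rho> :: 'x measure\<close>; actions form the finite
  type \<open>'a\<close>. Rewards and policies are curried functions \<open>'x \<Rightarrow> 'a \<Rightarrow> real\<close>.
\<close>

definition logistic :: "real \<Rightarrow> real" where
  "logistic u = 1 / (1 + exp (- u))"

subsection \<open>The f-divergence and the regularized objective\<close>

definition divergence_generator :: "(real \<Rightarrow> real) \<Rightarrow> bool" where
  "divergence_generator f \<longleftrightarrow>
     convex_on {0<..} f \<and>
     (\<exists>\<delta>>0. \<delta> \<le> 1 \<and> (\<forall>u\<in>{1-\<delta><..<1+\<delta>}. \<forall>v\<in>{1-\<delta><..<1+\<delta>}. \<forall>t. u \<noteq> v \<longrightarrow> 0 < t \<longrightarrow> t < 1 \<longrightarrow>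
        f ((1 - t) * u + t * v) < (1 - t) * f u + t * f v)) \<and>
     f 1 = 0 \<and>
     (\<forall>u>0. f differentiable at u) \<and>
     (\<forall>u>0. deriv f differentiable at u) \<and>
     continuous_on {0<..} (deriv (deriv f)) \<and>
     (\<forall>u>0. deriv (deriv f) u > 0)"

text \<open>
  A policy may assign probability 0 to an action, while \<open>f\<close> lives on \<open>(0,\<infinity>)\<close>; as usual for
  f-divergences, \<open>f 0\<close> stands for the limit of \<open>f\<close> at \<open>0\<close> from the right, which may be \<open>\<infinity>\<close>.
\<close>

definition f_ext :: "(real \<Rightarrow> real) \<Rightarrow> real \<Rightarrow> ereal" where
  "f_ext f u = (if u = 0 then Lim (at_right 0) (\<lambda>v. ereal (f v)) else ereal (f u))"

definition f_div :: "(real \<Rightarrow> real) \<Rightarrow> ('x \<Rightarrow> 'a::finite \<Rightarrow> real) \<Rightarrow> ('x \<Rightarrow> 'a \<Rightarrow> real) \<Rightarrow> 'x \<Rightarrow> ereal" where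
  "f_div f \<pi> \<pi>0 x = (\<Sum>a\<in>UNIV. ereal (\<pi>0 x a) * f_ext f (\<pi> x a / \<pi>0 x a))"

text \<open>
  Expectation of an extended real function as positive part minus negative part. It is only used
  for integrands bounded above by 1, so the first term is finite.
\<close>

definition expectation_ereal :: "'x measure \<Rightarrow> ('x \<Rightarrow> ereal) \<Rightarrow> ereal" where
  "expectation_ereal M g =
     enn2ereal (\<integral>\<^sup>+x. e2ennreal (g x) \<partial>M) - enn2ereal (\<integral>\<^sup>+x. e2ennreal (- g x) \<partial>M)"

definition policy :: "'x measure \<Rightarrow> ('x \<Rightarrow> 'a::finite \<Rightarrow> real) \<Rightarrow> bool" where
  "policy \<rho> \<pi> \<longleftrightarrow>
     (\<forall>a. (\<lambda>x. \<pi> x a) \<in> borel_measurable \<rho>) \<and> (\<forall>x a. 0 \<le> \<pi> x a) \<and> (\<forall>x. (\<Sum>a\<in>UNIV. \<pi> x a) = 1)"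

definition J_obj :: "(real \<Rightarrow> real) \<Rightarrow> real \<Rightarrow> ('x \<Rightarrow> 'a::finite \<Rightarrow> real) \<Rightarrow> 'x measure \<Rightarrow>
    ('x \<Rightarrow> 'a \<Rightarrow> real) \<Rightarrow> ('x \<Rightarrow> 'a \<Rightarrow> real) \<Rightarrow> ereal" where
  "J_obj f \<eta> \<pi>0 \<rho> rstar \<pi> =
     expectation_ereal \<rho>
       (\<lambda>x. ereal (\<Sum>a\<in>UNIV. \<pi> x a * rstar x a) - ereal (1 / \<eta>) * f_div f \<pi> \<pi>0 x)"

definition opt_policy :: "(real \<Rightarrow> real) \<Rightarrow> real \<Rightarrow> ('x \<Rightarrow> 'a::finite \<Rightarrow> real) \<Rightarrow> 'x measure \<Rightarrow>
    ('x \<Rightarrow> 'a \<Rightarrow> real) \<Rightarrow> 'x \<Rightarrow> 'a \<Rightarrow> real" where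
  "opt_policy f \<eta> \<pi>0 \<rho> rstar = arg_max (J_obj f \<eta> \<pi>0 \<rho> rstar) (policy \<rho>)"

subsection \<open>Policies induced by a reward function\<close>

definition h_inv :: "(real \<Rightarrow> real) \<Rightarrow> real \<Rightarrow> real" where
  "h_inv f = the_inv_into {0<..} (deriv f)"

text \<open>
  The range of \<open>deriv f\<close> on \<open>(0,\<infinity>)\<close> may be bounded above, and \<open>h_inv f\<close> is meaningful only on that
  range; the first conjunct keeps all arguments of \<open>h_inv f\<close> there.
\<close>

definition lam :: "(real \<Rightarrow> real) \<Rightarrow> real \<Rightarrow> ('x \<Rightarrow> 'a::finite \<Rightarrow> real) \<Rightarrow> ('x \<Rightarrow> 'a \<Rightarrow> real) \<Rightarrow> 'x \<Rightarrow> real" where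
  "lam f \<eta> \<pi>0 r x = (THE l.
     (\<forall>a. \<eta> * (r x a - l) \<in> deriv f ` {0<..}) \<and>
     (\<Sum>a\<in>UNIV. \<pi>0 x a * h_inv f (\<eta> * (r x a - l))) = 1)"

definition reward_policy :: "(real \<Rightarrow> real) \<Rightarrow> real \<Rightarrow> ('x \<Rightarrow> 'a::finite \<Rightarrow> real) \<Rightarrow>
    ('x \<Rightarrow> 'a \<Rightarrow> real) \<Rightarrow> 'x \<Rightarrow> 'a \<Rightarrow> real" where
  "reward_policy f \<eta> \<pi>0 r x a = \<pi>0 x a * h_inv f (\<eta> * (r x a - lam f \<eta> \<pi>0 r x))"

definition T_bar :: "(real \<Rightarrow> real) \<Rightarrow> real \<Rightarrow> ('x \<Rightarrow> 'a::finite \<Rightarrow> real) \<Rightarrow> ('x \<Rightarrow> 'a \<Rightarrow> real) \<Rightarrow> 'x \<Rightarrow> real" where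
  "T_bar f \<eta> \<pi>0 r x =
     (\<Sum>a\<in>UNIV. \<pi>0 x a * deriv (h_inv f) (\<eta> * (r x a - lam f \<eta> \<pi>0 r x)))"

definition deriv_policy :: "(real \<Rightarrow> real) \<Rightarrow> real \<Rightarrow> ('x \<Rightarrow> 'a::finite \<Rightarrow> real) \<Rightarrow>
    ('x \<Rightarrow> 'a \<Rightarrow> real) \<Rightarrow> 'x \<Rightarrow> 'a \<Rightarrow> real" where
  "deriv_policy f \<eta> \<pi>0 r x a =
     \<pi>0 x a * deriv (h_inv f) (\<eta> * (r x a - lam f \<eta> \<pi>0 r x)) / T_bar f \<eta> \<pi>0 r x"

definition Z_plus :: "(real \<Rightarrow> real) \<Rightarrow> real \<Rightarrow> ('x \<Rightarrow> 'a::finite \<Rightarrow> real) \<Rightarrow> ('x \<Rightarrow> 'a \<Rightarrow> real) \<Rightarrow> 'x \<Rightarrow> real" where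
  "Z_plus f \<eta> \<pi>0 r x = (\<Sum>a\<in>UNIV. deriv_policy f \<eta> \<pi>0 r x a * exp (r x a))"

definition Z_minus :: "(real \<Rightarrow> real) \<Rightarrow> real \<Rightarrow> ('x \<Rightarrow> 'a::finite \<Rightarrow> real) \<Rightarrow> ('x \<Rightarrow> 'a \<Rightarrow> real) \<Rightarrow> 'x \<Rightarrow> real" where
  "Z_minus f \<eta> \<pi>0 r x = (\<Sum>a\<in>UNIV. deriv_policy f \<eta> \<pi>0 r x a * exp (- r x a))"

definition policy_plus :: "(real \<Rightarrow> real) \<Rightarrow> real \<Rightarrow> ('x \<Rightarrow> 'a::finite \<Rightarrow> real) \<Rightarrow>
    ('x \<Rightarrow> 'a \<Rightarrow> real) \<Rightarrow> 'x \<Rightarrow> 'a \<Rightarrow> real" where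
  "policy_plus f \<eta> \<pi>0 r x a = deriv_policy f \<eta> \<pi>0 r x a * exp (r x a) / Z_plus f \<eta> \<pi>0 r x"

definition policy_minus :: "(real \<Rightarrow> real) \<Rightarrow> real \<Rightarrow> ('x \<Rightarrow> 'a::finite \<Rightarrow> real) \<Rightarrow>
    ('x \<Rightarrow> 'a \<Rightarrow> real) \<Rightarrow> 'x \<Rightarrow> 'a \<Rightarrow> real" where
  "policy_minus f \<eta> \<pi>0 r x a = deriv_policy f \<eta> \<pi>0 r x a * exp (- r x a) / Z_minus f \<eta> \<pi>0 r x"

definition mix_prob :: "(real \<Rightarrow> real) \<Rightarrow> real \<Rightarrow> ('x \<Rightarrow> 'a::finite \<Rightarrow> real) \<Rightarrow> ('x \<Rightarrow> 'a \<Rightarrow> real) \<Rightarrow> 'x \<Rightarrow> real" where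
  "mix_prob f \<eta> \<pi>0 r x =
     Z_plus f \<eta> \<pi>0 r x * Z_minus f \<eta> \<pi>0 r x / (1 + Z_plus f \<eta> \<pi>0 r x * Z_minus f \<eta> \<pi>0 r x)"

definition raw_weight :: "(real \<Rightarrow> real) \<Rightarrow> real \<Rightarrow> ('x \<Rightarrow> 'a::finite \<Rightarrow> real) \<Rightarrow> ('x \<Rightarrow> 'a \<Rightarrow> real) \<Rightarrow> 'x \<Rightarrow> real" where
  "raw_weight f \<eta> \<pi>0 r x =
     T_bar f \<eta> \<pi>0 r x + Z_plus f \<eta> \<pi>0 r x * Z_minus f \<eta> \<pi>0 r x * T_bar f \<eta> \<pi>0 r x"

definition weight :: "(real \<Rightarrow> real) \<Rightarrow> real \<Rightarrow> ('x \<Rightarrow> 'a::finite \<Rightarrow> real) \<Rightarrow> 'x measure \<Rightarrow>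
    ('x \<Rightarrow> 'a \<Rightarrow> real) \<Rightarrow> 'x \<Rightarrow> real" where
  "weight f \<eta> \<pi>0 \<rho> r x = raw_weight f \<eta> \<pi>0 r x / (\<integral>x'. raw_weight f \<eta> \<pi>0 r x' \<partial>\<rho>)"

subsection \<open>The derivative-based exploration algorithm\<close>

text \<open>Probability that the two-branch sampling scheme of a round draws \<open>(a\<^sup>1, a\<^sup>2) = (a, b)\<close> in context \<open>x\<close>.\<close>

definition pair_prob :: "(real \<Rightarrow> real) \<Rightarrow> real \<Rightarrow> ('x \<Rightarrow> 'a::finite \<Rightarrow> real) \<Rightarrow>
    ('x \<Rightarrow> 'a \<Rightarrow> real) \<Rightarrow> 'x \<Rightarrow> 'a \<Rightarrow> 'a \<Rightarrow> real" where
  "pair_prob f \<eta> \<pi>0 r x a b =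
     (1 - mix_prob f \<eta> \<pi>0 r x) * (deriv_policy f \<eta> \<pi>0 r x a * deriv_policy f \<eta> \<pi>0 r x b) +
     mix_prob f \<eta> \<pi>0 r x * (policy_plus f \<eta> \<pi>0 r x a * policy_minus f \<eta> \<pi>0 r x b)"

text \<open>Bradley--Terry law of the feedback bit; \<open>True\<close> means that the first action is preferred.\<close>

definition pref_prob :: "('x \<Rightarrow> 'a \<Rightarrow> real) \<Rightarrow> 'x \<Rightarrow> 'a \<Rightarrow> 'a \<Rightarrow> bool \<Rightarrow> real" where
  "pref_prob rstar x a b y =
     (if y then logistic (rstar x a - rstar x b) else 1 - logistic (rstar x a - rstar x b))"

definition winner :: "'a \<Rightarrow> 'a \<Rightarrow> bool \<Rightarrow> 'a" where
  "winner a b y = (if y then a else b)"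

definition loser :: "'a \<Rightarrow> 'a \<Rightarrow> bool \<Rightarrow> 'a" where
  "loser a b y = (if y then b else a)"

text \<open>Here \<open>w\<close> is the weight function, \<open>r\<close> the candidate reward and \<open>x\<close>, \<open>a1\<close>, \<open>a2\<close>, \<open>y\<close> the data.\<close>

definition weighted_nll :: "('x \<Rightarrow> real) \<Rightarrow> nat \<Rightarrow> (nat \<Rightarrow> 'x) \<Rightarrow> (nat \<Rightarrow> 'a) \<Rightarrow> (nat \<Rightarrow> 'a) \<Rightarrow> (nat \<Rightarrow> bool) \<Rightarrow>
    ('x \<Rightarrow> 'a \<Rightarrow> real) \<Rightarrow> real" where
  "weighted_nll w t x a1 a2 y r =
     - (1 / real t) * (\<Sum>i=1..t. w (x i) *
          ln (logistic (r (x i) (winner (a1 i) (a2 i) (y i)) - r (x i) (loser (a1 i) (a2 i) (y i)))))"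

text \<open>
  A run of the algorithm on a probability space \<open>M\<close>: \<open>F t\<close> is the information available after round
  \<open>t\<close> (possibly including auxiliary randomness for tie-breaking), \<open>X t\<close>, \<open>A1 t\<close>, \<open>A2 t\<close>, \<open>Y t\<close> are the
  data of round \<open>t \<ge> 1\<close>, and \<open>\<theta> t\<close> is the parameter computed in it. The conditional law of round
  \<open>t + 1\<close> given \<open>F t\<close> is specified by integrating over the events \<open>E\<close> of \<open>F t\<close>. Measurability of the
  parameter is only required of the selected reward function, whose set of values \<open>r ` \<Theta>\<close> is finite
  in the theorem. The weight used in round \<open>t + 1\<close> is, for all summands of the loss, the one at the
  parameter \<open>\<theta> t\<close> from which the actions of that round are sampled.
\<close>

definition exploration_run :: "(real \<Rightarrow> real) \<Rightarrow> real \<Rightarrow> ('x \<Rightarrow> 'a::finite \<Rightarrow> real) \<Rightarrow> 'x measure \<Rightarrow>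
    'p set \<Rightarrow> ('p \<Rightarrow> 'x \<Rightarrow> 'a \<Rightarrow> real) \<Rightarrow> ('x \<Rightarrow> 'a \<Rightarrow> real) \<Rightarrow>
    'w measure \<Rightarrow> (nat \<Rightarrow> 'w measure) \<Rightarrow> (nat \<Rightarrow> 'w \<Rightarrow> 'x) \<Rightarrow> (nat \<Rightarrow> 'w \<Rightarrow> 'a) \<Rightarrow> (nat \<Rightarrow> 'w \<Rightarrow> 'a) \<Rightarrow>
    (nat \<Rightarrow> 'w \<Rightarrow> bool) \<Rightarrow> (nat \<Rightarrow> 'w \<Rightarrow> 'p) \<Rightarrow> bool" where
  "exploration_run f \<eta> \<pi>0 \<rho> \<Theta> r rstar M F X A1 A2 Y \<theta> \<longleftrightarrow>
     prob_space M \<and> filtration (space M) F \<and> (\<forall>t. sets (F t) \<subseteq> sets M) \<and>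
     (\<forall>t\<ge>1. X t \<in> F t \<rightarrow>\<^sub>M \<rho> \<and> A1 t \<in> F t \<rightarrow>\<^sub>M count_space UNIV \<and>
            A2 t \<in> F t \<rightarrow>\<^sub>M count_space UNIV \<and> Y t \<in> F t \<rightarrow>\<^sub>M count_space UNIV) \<and>
     (\<forall>t. (\<lambda>\<omega>. r (\<theta> t \<omega>)) \<in> F t \<rightarrow>\<^sub>M count_space (r ` \<Theta>)) \<and>
     (\<exists>\<theta>0\<in>\<Theta>. \<forall>\<omega>\<in>space M. \<theta> 0 \<omega> = \<theta>0) \<and>
     (\<forall>t. \<forall>E\<in>sets (F t). \<forall>B\<in>sets \<rho>. \<forall>a b y.
        measure M {\<omega>\<in>E. X (Suc t) \<omega> \<in> B \<and> A1 (Suc t) \<omega> = a \<and> A2 (Suc t) \<omega> = b \<and> Y (Suc t) \<omega> = y} =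
        (LINT \<omega>:E|M. (LINT x:B|\<rho>. pair_prob f \<eta> \<pi>0 (r (\<theta> t \<omega>)) x a b * pref_prob rstar x a b y))) \<and>
     (\<forall>t. \<forall>\<omega>\<in>space M.
        is_arg_min
          (\<lambda>\<phi>. weighted_nll (weight f \<eta> \<pi>0 \<rho> (r (\<theta> t \<omega>))) (Suc t)
                 (\<lambda>i. X i \<omega>) (\<lambda>i. A1 i \<omega>) (\<lambda>i. A2 i \<omega>) (\<lambda>i. Y i \<omega>) (r \<phi>))
          (\<lambda>\<phi>. \<phi> \<in> \<Theta>) (\<theta> (Suc t) \<omega>))"

subsection \<open>The constants of the bound\<close>

definition reward_hull :: "('x \<Rightarrow> 'a \<Rightarrow> real) set \<Rightarrow> ('x \<Rightarrow> 'a \<Rightarrow> real) set" where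
  "reward_hull R = {(\<lambda>x a. \<Sum>r\<in>S. c r * r x a) | S c.
     finite S \<and> S \<noteq> {} \<and> S \<subseteq> R \<and> (\<forall>r\<in>S. 0 \<le> c r) \<and> (\<Sum>r\<in>S. c r) = 1}"

text \<open>
  Suprema are taken in the extended reals: when \<open>deriv f\<close> is bounded above and \<open>\<pi>0\<close> is not bounded
  away from \<open>0\<close>, the constants may be infinite.
\<close>

definition M_const :: "(real \<Rightarrow> real) \<Rightarrow> ('x \<Rightarrow> 'a::finite \<Rightarrow> real) set \<Rightarrow> real \<Rightarrow> ('x \<Rightarrow> 'a \<Rightarrow> real) \<Rightarrow> ereal" where
  "M_const f R \<eta> \<pi>0 = (SUP r\<in>reward_hull R. SUP x. ereal
     (\<Sum>a\<in>UNIV. \<pi>0 x a * deriv (h_inv f) (\<eta> * (r x a - lam f \<eta> \<pi>0 r x))))"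

definition sup_norm :: "('x \<Rightarrow> real) \<Rightarrow> ereal" where
  "sup_norm g = (SUP x. ereal \<bar>g x\<bar>)"

definition C0_const :: "(real \<Rightarrow> real) \<Rightarrow> ('x \<Rightarrow> 'a::finite \<Rightarrow> real) set \<Rightarrow> real \<Rightarrow> ('x \<Rightarrow> 'a \<Rightarrow> real) \<Rightarrow>
    real \<Rightarrow> ('x \<Rightarrow> 'a \<Rightarrow> real) \<Rightarrow> ereal" where
  "C0_const f R \<eta> \<pi>0 C r = ereal (2 * \<eta> * C) * M_const f R \<eta> \<pi>0 *
     sup_norm (\<lambda>x. T_bar f \<eta> \<pi>0 r x + T_bar f \<eta> \<pi>0 r x * Z_plus f \<eta> \<pi>0 r x * Z_minus f \<eta> \<pi>0 r x)"

text \<open>Law of the sum of the squares of \<open>d\<close> independent standard normal variables.\<close>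

definition chi_square :: "nat \<Rightarrow> real measure" where
  "chi_square d = distr (PiM {..<d} (\<lambda>_. density lborel (\<lambda>z. ennreal (std_normal_density z)))) borel
     (\<lambda>z. \<Sum>i<d. (z i)\<^sup>2)"

end

theory Submission
  imports Defs
begin

text \<open>
  The class is finite, so the gap is eventually exactly zero with probability tending to one. If
  \<open>C0\<close> is infinite, the event is empty because all objectives involved are finite. Otherwise
  the weights are bounded, and the probability that the algorithm selects a reward whose differences
  \<open>r x a - r x b\<close> are not those of \<open>rstar\<close> decays geometrically: a minimizer of the weighted
  loss has a likelihood ratio product (exponents being a small multiple of the weights) of at least 1,
  while the expectation of that product shrinks in each round by a factor below 1, by strict
  concavity. A reward with the differences of \<open>rstar\<close> induces the optimal policy.
\<close>

subsection \<open>The tail of the chi-squared distribution\<close>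

text \<open>The obstacle is that the weights are random: round t + 1 reweights all past summands
  with the weight at \<open>\<theta> t\<close>, which itself depends on the data. Finiteness of the
  class removes this. For fixed values \<psi> of \<open>r (\<theta> t)\<close> and \<phi> of the
  next reward, the exponents are a deterministic function of the context, and the event that both
  values occur lies in the event that one fixed product is at least 1. The exponents must stay below
  1, because a likelihood ratio raised to a power above 1 has mean at least 1 by Jensen. Rescaling
  them is harmless: multiplying the loss by a positive constant keeps its minimizers. How small the
  factor must be is governed by a bound on \<open>T_bar\<close>, and \<open>M_const\<close> supplies
  it, since each reward of the class lies in the hull. Strict contraction rests on every action pair
  having positive sampling probability at every parameter, so a round contributes a factor below 1
  whatever reward it was sampled with. Preferences reveal only reward differences, and this suffices
  because the multiplier \<open>lam\<close> absorbs constants added to a reward in a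
  context.\<close>

lemma nn_integral_exp_square_std_normal:
  assumes "0 \<le> t" "t < 1 / 2"
  shows "(\<integral>\<^sup>+z. ennreal (exp (t * z\<^sup>2)) \<partial>density lborel (\<lambda>z. ennreal (std_normal_density z)))
           = ennreal (1 / sqrt (1 - 2 * t))"
proof -
  \<comment> \<open>The factor exp (t z^2) turns the standard normal density into s times the
    centred normal density with standard deviation s, so the integral equals s.\<close>
  define s where "s = 1 / sqrt (1 - 2 * t)"
  have pos: "1 - 2 * t > 0" using assms by simp
  then have s: "s > 0" "s\<^sup>2 = 1 / (1 - 2 * t)" by (auto simp: s_def power_divide)
  have eq: "std_normal_density z * exp (t * z\<^sup>2) = s * normal_density 0 s z" for z
  proof -
    have "- z\<^sup>2 / 2 + t * z\<^sup>2 = - z\<^sup>2 / (2 * s\<^sup>2)"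
      using pos by (simp add: s(2) field_simps)
    moreover have "1 / sqrt (2 * pi) = s * (1 / sqrt (2 * pi * s\<^sup>2))"
      using s(1) by (simp add: real_sqrt_mult)
    ultimately show ?thesis
      by (simp add: normal_density_def exp_add[symmetric] mult.assoc)
  qed
  have "(\<integral>\<^sup>+z. ennreal (exp (t * z\<^sup>2)) \<partial>density lborel (\<lambda>z. ennreal (std_normal_density z)))
      = (\<integral>\<^sup>+z. ennreal (std_normal_density z) * ennreal (exp (t * z\<^sup>2)) \<partial>lborel)"
    by (subst nn_integral_density) auto
  also have "\<dots> = (\<integral>\<^sup>+z. ennreal s * ennreal (normal_density 0 s z) \<partial>lborel)"
    using s(1) by (intro nn_integral_cong) (simp add: ennreal_mult[symmetric] eq)
  also have "\<dots> = ennreal s * (\<integral>\<^sup>+z. ennreal (normal_density 0 s z) \<partial>lborel)"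
    by (rule nn_integral_cmult) simp
  also have "(\<integral>\<^sup>+z. ennreal (normal_density 0 s z) \<partial>lborel) = 1"
    using prob_space.emeasure_space_1[OF prob_space_normal_density[OF s(1), of 0]]
    by (simp add: emeasure_density)
  finally show ?thesis by (simp add: s_def)
qed

text \<open>Chernoff bound: Markov's inequality for exp (t * q), where q is the sum of squares,
  whose mean factorizes over the independent coordinates.\<close>

lemma chi_square_tail:
  assumes "\<epsilon> > 0"
  shows "measure (chi_square d) {z. z \<ge> real d * (1 + \<epsilon>)} \<le> exp (- (real d / 2) * (\<epsilon> - ln (1 + \<epsilon>)))"
proof -
  let ?N = "density lborel (\<lambda>z. ennreal (std_normal_density z))"
  let ?P = "PiM {..<d} (\<lambda>_. ?N)" and ?q = "\<lambda>z. \<Sum>i<d. (z i)\<^sup>2"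
  \<comment> \<open>This t minimizes the exponent - t d (1 + \<epsilon>) - (d / 2) ln (1 - 2 t) of
    the Chernoff bound; the stationarity condition is 1 - 2 t = 1 / (1 + \<epsilon>).\<close>
  define t where "t = \<epsilon> / (2 * (1 + \<epsilon>))"
  have t: "0 \<le> t" "t < 1 / 2" "1 / sqrt (1 - 2 * t) = sqrt (1 + \<epsilon>)"
  proof -
    show "0 \<le> t" "t < 1 / 2" using assms by (auto simp: t_def field_simps)
    have "1 - 2 * t = 1 / (1 + \<epsilon>)" using assms by (simp add: t_def field_simps)
    then show "1 / sqrt (1 - 2 * t) = sqrt (1 + \<epsilon>)" by (simp add: real_sqrt_divide)
  qed
  interpret prob_space ?N by (rule prob_space_normal_density) simp
  interpret product_sigma_finite "\<lambda>_::nat. ?N" ..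
  interpret P: prob_space ?P by (rule prob_space_PiM) (rule prob_space_axioms)
  have "(\<integral>\<^sup>+z. ennreal (exp (t * ?q z)) \<partial>?P) = (\<integral>\<^sup>+z. (\<Prod>i<d. ennreal (exp (t * (z i)\<^sup>2))) \<partial>?P)"
    by (intro nn_integral_cong) (simp add: sum_distrib_left exp_sum prod_ennreal)
  also have "\<dots> = (\<Prod>i<d. (\<integral>\<^sup>+z. ennreal (exp (t * z\<^sup>2)) \<partial>?N))"
    by (rule product_nn_integral_prod) auto
  also have "\<dots> = ennreal (sqrt (1 + \<epsilon>) ^ d)"
    using assms by (simp add: nn_integral_exp_square_std_normal[OF t(1,2)] t(3) ennreal_power)
  finally have mgf: "(\<integral>\<^sup>+z. ennreal (exp (t * ?q z)) \<partial>?P) = ennreal (sqrt (1 + \<epsilon>) ^ d)" .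
  let ?c = "exp (- t * (real d * (1 + \<epsilon>)))"
  have "emeasure (chi_square d) {z. z \<ge> real d * (1 + \<epsilon>)} = emeasure ?P {z\<in>space ?P. ?q z \<ge> real d * (1 + \<epsilon>)}"
    unfolding chi_square_def
    by (subst emeasure_distr) (auto intro!: arg_cong[where f = "emeasure ?P"])
  also have "\<dots> \<le> (\<integral>\<^sup>+z. ennreal ?c * ennreal (exp (t * ?q z)) \<partial>?P)"
  proof (subst nn_integral_indicator[symmetric])
    show "(\<integral>\<^sup>+z. indicator {z\<in>space ?P. ?q z \<ge> real d * (1 + \<epsilon>)} z \<partial>?P)
        \<le> (\<integral>\<^sup>+z. ennreal ?c * ennreal (exp (t * ?q z)) \<partial>?P)"
    proof (intro nn_integral_mono)
      fix z
      have "t * (real d * (1 + \<epsilon>)) \<le> t * ?q z" if "?q z \<ge> real d * (1 + \<epsilon>)"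
        using that t(1) by (rule mult_left_mono)
      then show "indicator {z\<in>space ?P. ?q z \<ge> real d * (1 + \<epsilon>)} z \<le> ennreal ?c * ennreal (exp (t * ?q z))"
        by (auto simp: indicator_def ennreal_mult[symmetric] exp_add[symmetric] simp flip: ennreal_1)
    qed
  qed measurable
  also have "\<dots> = ennreal ?c * ennreal (sqrt (1 + \<epsilon>) ^ d)"
    by (subst nn_integral_cmult) (simp_all add: mgf)
  also have "\<dots> = ennreal (exp (- (real d / 2) * (\<epsilon> - ln (1 + \<epsilon>))))"
  proof -
    have "sqrt (1 + \<epsilon>) ^ d = exp (real d * (ln (1 + \<epsilon>) / 2))"
      using assms unfolding exp_of_nat_mult by (simp add: powr_half_sqrt[symmetric] powr_def)
    moreover have "t * (1 + \<epsilon>) = \<epsilon> / 2" using assms by (simp add: t_def field_simps)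
    then have "real d * (t * (1 + \<epsilon>)) = real d * (\<epsilon> / 2)" by (rule arg_cong)
    then have "- t * (real d * (1 + \<epsilon>)) = - (real d) * (\<epsilon> / 2)"
      by (simp only: mult_minus_left mult.left_commute)
    moreover have "- (real d) * (\<epsilon> / 2) + real d * (ln (1 + \<epsilon>) / 2) = - (real d / 2) * (\<epsilon> - ln (1 + \<epsilon>))"
      by (simp add: field_simps)
    ultimately have "?c * sqrt (1 + \<epsilon>) ^ d = exp (- (real d / 2) * (\<epsilon> - ln (1 + \<epsilon>)))"
      by (simp only: exp_add[symmetric])
    moreover have "0 \<le> sqrt (1 + \<epsilon>) ^ d" using assms by simp
    ultimately show ?thesis by (metis ennreal_mult exp_ge_zero)
  qed
  finally show ?thesis
    unfolding measure_def by (intro enn2real_leI) auto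
qed

subsection \<open>Tempered likelihood ratios\<close>

text \<open>The power function with exponent \<tau> is strictly concave, so it lies below its
  tangent at 1 and touches it only there.\<close>

lemma exp_ln_less_tangent:
  fixes t \<tau> :: real
  assumes "t > 0" "0 < \<tau>" "\<tau> < 1"
  shows "exp (\<tau> * ln t) \<le> 1 + \<tau> * (t - 1)"
    and "exp (\<tau> * ln t) = 1 + \<tau> * (t - 1) \<Longrightarrow> t = 1"
proof -
  \<comment> \<open>m is the weighted mean of t and 1. The inequality ln x \<le> x - 1 is applied at
    t / m and 1 / m with weights \<tau> and 1 - \<tau>, for which the right-hand sides cancel;
    equality therefore forces equality at 1 / m, that is m = 1.\<close>
  define m where "m = 1 + \<tau> * (t - 1)"
  have "m = (1 - \<tau>) + \<tau> * t" by (simp add: m_def algebra_simps)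
  then have m: "m > 0" using assms by (simp add: add_pos_pos)
  have 1: "\<tau> * (ln t - ln m) \<le> \<tau> * (t / m - 1)"
    using ln_le_minus_one[of "t / m"] assms m by (simp add: ln_div)
  have 2: "(1 - \<tau>) * (- ln m) \<le> (1 - \<tau>) * (1 / m - 1)"
    using ln_le_minus_one[of "1 / m"] assms m by (intro mult_left_mono) (auto simp: ln_div)
  have 3: "\<tau> * (t / m - 1) + (1 - \<tau>) * (1 / m - 1) = 0"
    using m by (simp add: field_simps) (simp add: m_def algebra_simps)
  have "\<tau> * ln t \<le> ln m" using 1 2 3 by (simp add: algebra_simps)
  then show "exp (\<tau> * ln t) \<le> 1 + \<tau> * (t - 1)"
    using m by (simp add: ln_ge_iff m_def[symmetric])
  assume "exp (\<tau> * ln t) = 1 + \<tau> * (t - 1)"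
  then have "\<tau> * ln t = ln m" by (metis ln_exp m_def)
  then have "(1 - \<tau>) * (- ln m) = (1 - \<tau>) * (1 / m - 1)"
    using 1 2 3 by (simp add: algebra_simps)
  then have "- ln m = 1 / m - 1" using assms by (subst (asm) mult_left_cancel) auto
  then have "ln (1 / m) = 1 / m - 1" using m by (simp add: ln_div)
  then have "1 / m = 1" using m by (intro ln_eq_minus_one) auto
  then have "\<tau> * (t - 1) = 0" by (simp add: m_def)
  then show "t = 1" using assms by simp
qed

text \<open>\<open>A\<close> is the Hellinger-type affinity, the sum of u^(1-\<tau>) v^\<tau> and
  its complement, of the Bernoulli laws with parameters u and v. Replacing each power of a
  likelihood ratio by its tangent at 1 gives total mass exactly 1, so equality is possible only at
  ratio 1.\<close>

lemma tilted_Bernoulli: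
  fixes u v \<tau> :: real
  defines "A \<equiv> u * exp (\<tau> * (ln v - ln u)) + (1 - u) * exp (\<tau> * (ln (1 - v) - ln (1 - u)))"
  assumes "0 < u" "u < 1" "0 < v" "v < 1" "0 < \<tau>" "\<tau> < 1"
  shows "A \<le> 1" and "A = 1 \<Longrightarrow> u = v"
proof -
  let ?B = "\<lambda>t. 1 + \<tau> * (t - 1)"
  have eqs: "ln v - ln u = ln (v / u)" "ln (1 - v) - ln (1 - u) = ln ((1 - v) / (1 - u))"
    using assms by (auto simp: ln_div)
  have 1: "u * exp (\<tau> * ln (v / u)) \<le> u * ?B (v / u)"
    using assms by (intro mult_left_mono exp_ln_less_tangent) auto
  have 2: "(1 - u) * exp (\<tau> * ln ((1 - v) / (1 - u))) \<le> (1 - u) * ?B ((1 - v) / (1 - u))"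
    using assms by (intro mult_left_mono exp_ln_less_tangent) auto
  have "u * ?B (v / u) = u + \<tau> * (v - u)" "(1 - u) * ?B ((1 - v) / (1 - u)) = (1 - u) + \<tau> * (u - v)"
    using assms by (auto simp: field_simps)
  then have 3: "u * ?B (v / u) + (1 - u) * ?B ((1 - v) / (1 - u)) = 1"
    by (simp add: algebra_simps)
  show "A \<le> 1" unfolding A_def eqs using 1 2 3 by linarith
  assume "A = 1"
  then have "u * exp (\<tau> * ln (v / u)) = u * ?B (v / u)"
    unfolding A_def eqs using 1 2 3 by linarith
  then have "exp (\<tau> * ln (v / u)) = ?B (v / u)" using assms by simp
  then have "v / u = 1" using assms by (intro exp_ln_less_tangent(2)[of "v / u" \<tau>]) auto
  then show "u = v" by simp
qed

lemma logistic_bounds: "0 < logistic u" "logistic u < 1"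
  by (auto simp: logistic_def add_pos_pos)

lemma logistic_minus: "logistic (- u) = 1 - logistic u"
proof -
  have "1 + exp u > 0" "1 + exp (- u) > 0" by (auto simp: add_pos_pos)
  then show ?thesis by (simp add: logistic_def exp_minus field_simps)
qed

lemma logistic_eq_iff: "logistic u = logistic v \<longleftrightarrow> u = v"
proof -
  have "1 + exp (- u) > 0" "1 + exp (- v) > 0" by (auto simp: add_pos_pos)
  then show ?thesis by (auto simp: logistic_def)
qed

text \<open>Likelihood ratio of the observed preference under \<open>r\<close> against
  \<open>s\<close>, raised to the power \<open>\<tau> x\<close>. By the antisymmetry of the logistic
  function, the difference winner minus loser gives the probability of the observed bit in both
  cases.\<close>

definition tilt :: "('x \<Rightarrow> real) \<Rightarrow> ('x \<Rightarrow> 'a \<Rightarrow> real) \<Rightarrow> ('x \<Rightarrow> 'a \<Rightarrow> real) \<Rightarrow> 'x \<Rightarrow> 'a \<times> 'a \<times> bool \<Rightarrow> real" where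
  "tilt \<tau> r s x = (\<lambda>(a, b, y). exp (\<tau> x * (ln (logistic (r x (winner a b y) - r x (loser a b y)))
      - ln (logistic (s x (winner a b y) - s x (loser a b y))))))"

text \<open>For a fixed action pair this is the Bernoulli affinity of the two preference laws.
  Equality makes the preference probabilities agree, and injectivity of the logistic function turns
  this into equal reward differences.\<close>

lemma tilt_mean:
  assumes "0 < \<tau> x" "\<tau> x < 1"
  shows "(\<Sum>y\<in>UNIV. pref_prob s x a b y * tilt \<tau> r s x (a, b, y)) \<le> 1" (is "?S \<le> 1")
    and "(\<Sum>y\<in>UNIV. pref_prob s x a b y * tilt \<tau> r s x (a, b, y)) = 1 \<Longrightarrow> r x a - r x b = s x a - s x b"
proof -
  let ?u = "logistic (s x a - s x b)" and ?v = "logistic (r x a - r x b)"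
  have "logistic (s x b - s x a) = 1 - ?u" "logistic (r x b - r x a) = 1 - ?v"
    by (simp_all add: logistic_minus[symmetric])
  then have eq: "?S = ?u * exp (\<tau> x * (ln ?v - ln ?u)) + (1 - ?u) * exp (\<tau> x * (ln (1 - ?v) - ln (1 - ?u)))"
    by (simp add: UNIV_bool pref_prob_def tilt_def winner_def loser_def)
  show "?S \<le> 1" unfolding eq by (intro tilted_Bernoulli logistic_bounds assms)
  assume "?S = 1"
  then have "?u = ?v" unfolding eq by (intro tilted_Bernoulli(2)[of ?u ?v "\<tau> x"] logistic_bounds assms)
  then show "r x a - r x b = s x a - s x b" by (simp add: logistic_eq_iff)
qed

subsection \<open>Inverting the derivative of the generator\<close>

locale regular_generator =
  fixes f :: "real \<Rightarrow> real" and \<eta> :: real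
  assumes eta: "\<eta> > 0"
    and generator: "divergence_generator f"
    and at_zero: "filterlim (deriv f) at_bot (at_right 0)"
begin

abbreviation "dom_h \<equiv> deriv f ` {0<..}"
abbreviation "h \<equiv> h_inv f"

lemma f_1: "f 1 = 0"
  using generator by (simp add: divergence_generator_def)

lemma DERIV_f: "u > 0 \<Longrightarrow> (f has_real_derivative deriv f u) (at u)"
  using generator by (simp add: divergence_generator_def DERIV_deriv_iff_real_differentiable)

lemma DERIV_f': "u > 0 \<Longrightarrow> (deriv f has_real_derivative deriv (deriv f) u) (at u)"
  using generator by (simp add: divergence_generator_def DERIV_deriv_iff_real_differentiable)

lemma f''_pos: "u > 0 \<Longrightarrow> deriv (deriv f) u > 0"
  using generator by (simp add: divergence_generator_def)

lemma f'_strict_mono: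
  assumes "0 < u" "u < v" shows "deriv f u < deriv f v"
proof (rule DERIV_pos_imp_increasing[OF assms(2)])
  fix z assume "u \<le> z" "z \<le> v"
  then have "z > 0" using assms by simp
  then show "\<exists>y. DERIV (deriv f) z :> y \<and> y > 0" using DERIV_f' f''_pos by blast
qed

lemma f'_less_iff: "0 < u \<Longrightarrow> 0 < v \<Longrightarrow> deriv f u < deriv f v \<longleftrightarrow> u < v"
  using f'_strict_mono[of u v] f'_strict_mono[of v u] by (cases u v rule: linorder_cases) auto

lemma f'_inj: "inj_on (deriv f) {0<..}"
proof (rule inj_onI)
  fix u v assume "u \<in> {0<..}" "v \<in> {0<..}" "deriv f u = deriv f v"
  then show "u = v" using f'_less_iff[of u v] f'_less_iff[of v u] by auto
qed

lemma f'_continuous: "continuous_on {0<..} (deriv f)"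
  by (auto intro!: continuous_at_imp_continuous_on DERIV_isCont[OF DERIV_f'])

lemma h_f': "u > 0 \<Longrightarrow> h (deriv f u) = u"
  unfolding h_inv_def by (rule the_inv_into_f_f[OF f'_inj]) simp

lemma f'_h: "v \<in> dom_h \<Longrightarrow> deriv f (h v) = v"
  unfolding h_inv_def by (rule f_the_inv_into_f[OF f'_inj])

lemma h_pos: "v \<in> dom_h \<Longrightarrow> h v > 0"
  using h_f' by auto

lemma h_less: "v \<in> dom_h \<Longrightarrow> w \<in> dom_h \<Longrightarrow> v < w \<Longrightarrow> h v < h w"
  using f'_less_iff[of "h v" "h w"] f'_h[of v] f'_h[of w] h_pos by simp

lemma h_le: "v \<in> dom_h \<Longrightarrow> w \<in> dom_h \<Longrightarrow> v \<le> w \<Longrightarrow> h v \<le> h w"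
  using h_less[of v w] by (cases "v = w") auto

text \<open>The divergence of the derivative to minus infinity at 0, combined with the intermediate
  value theorem, makes its range a down-set. Hence raising the multiplier never moves an argument of
  \<open>h\<close> out of the range.\<close>

lemma dom_h_downward: 
  assumes "w \<in> dom_h" "v \<le> w" shows "v \<in> dom_h"
proof -
  obtain u where u: "u > 0" "w = deriv f u" using assms by auto
  have "eventually (\<lambda>z. deriv f z \<le> v) (at_right 0)"
    using at_zero by (simp add: filterlim_at_bot)
  moreover have "eventually (\<lambda>z. z \<in> {0<..<u}) (at_right (0::real))"
    using u by (intro eventually_at_right_real)
  ultimately have "eventually (\<lambda>z. deriv f z \<le> v \<and> z \<in> {0<..<u}) (at_right 0)"
    by eventually_elim auto
  then obtain z where z: "deriv f z \<le> v" "0 < z" "z < u"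
    using eventually_happens[of _ "at_right (0::real)"] by force
  have "continuous_on {z..u} (deriv f)"
    by (rule continuous_on_subset[OF f'_continuous]) (use z in auto)
  then obtain y where "z \<le> y" "y \<le> u" "deriv f y = v"
    using IVT'[of "deriv f" z v u] z u assms by auto
  then show ?thesis using z by force
qed

text \<open>Inverse function theorem, applied on the open half-line; together with continuity and
  positivity of the second derivative of f it yields a positive and continuous derivative of
  \<open>h\<close>.\<close>

lemma DERIV_h:
  assumes "v \<in> dom_h"
  shows "(h has_real_derivative inverse (deriv (deriv f) (h v))) (at v)"
proof -
  let ?c = "deriv (deriv f) (h v)"
  have pos: "h v > 0" by (rule h_pos[OF assms])
  have "(h has_derivative (*) (inverse ?c)) (at (deriv f (h v)))"
  proof (rule has_derivative_inverse_strong[where S = "{0<..}" and f = "deriv f" and x = "h v" and f' = "(*) ?c"])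
    show "(deriv f has_derivative (*) ?c) (at (h v))"
      using DERIV_f'[OF pos] by (simp add: has_field_derivative_def)
    show "(*) ?c \<circ> (*) (inverse ?c) = id"
      using f''_pos[OF pos] by (auto simp: fun_eq_iff)
  qed (use pos f'_continuous h_f' in auto)
  then show ?thesis using f'_h[OF assms] by (simp add: has_field_derivative_def)
qed

lemma deriv_h: "v \<in> dom_h \<Longrightarrow> deriv h v = inverse (deriv (deriv f) (h v))"
  using DERIV_h by (rule DERIV_imp_deriv)

lemma deriv_h_pos: "v \<in> dom_h \<Longrightarrow> deriv h v > 0"
  by (simp add: deriv_h f''_pos h_pos)

lemma h_continuous: "continuous_on dom_h h"
  by (auto intro!: continuous_at_imp_continuous_on DERIV_isCont[OF DERIV_h])

lemma deriv_h_continuous: "continuous_on dom_h (deriv h)"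
proof -
  have "continuous_on {0<..} (deriv (deriv f))"
    using generator by (simp add: divergence_generator_def)
  then have "continuous_on dom_h (\<lambda>v. inverse (deriv (deriv f) (h v)))"
    using h_pos f''_pos
    by (intro continuous_on_inverse continuous_on_compose2[OF _ h_continuous])
      (auto simp: less_imp_neq[THEN not_sym])
  then show ?thesis
    by (rule continuous_on_eq) (simp add: deriv_h)
qed

lemma dom_h_borel: "dom_h \<in> sets borel"
  using dom_h_downward unfolding is_interval_1
  by (intro real_interval_borel_measurable) (auto simp: is_interval_1 simp del: image_iff)

text \<open>Outside \<open>dom_h\<close> the values of \<open>h\<close> are unspecified. Setting
  them to 0 gives a Borel function on the whole line that agrees with \<open>h\<close> at all
  arguments that actually occur.\<close>

definition h_total :: "real \<Rightarrow> real" where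
  "h_total v = (if v \<in> dom_h then h v else 0)"

definition deriv_h_total :: "real \<Rightarrow> real" where
  "deriv_h_total v = (if v \<in> dom_h then deriv h v else 0)"

lemma h_total_borel [measurable]: "h_total \<in> borel_measurable borel"
  unfolding h_total_def[abs_def]
  by (rule borel_measurable_continuous_on_if[OF dom_h_borel h_continuous continuous_on_const])

lemma deriv_h_total_borel [measurable]: "deriv_h_total \<in> borel_measurable borel"
  unfolding deriv_h_total_def[abs_def]
  by (rule borel_measurable_continuous_on_if[OF dom_h_borel deriv_h_continuous continuous_on_const])

section \<open>Tangent inequalities for the generator, including its boundary value at 0\<close>

lemma f_tangent:
  assumes "u > 0" "v > 0" shows "f u + deriv f u * (v - u) \<le> f v"
proof -
  have "f v - f u \<ge> deriv f u * (v - u)"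
    by (rule convex_on_imp_above_tangent[where A = "{0<..}"])
      (use assms generator DERIV_f in
        \<open>auto simp: divergence_generator_def interior_open intro: has_field_derivative_at_within\<close>)
  then show ?thesis by simp
qed

text \<open>\<open>Lim\<close> is meaningful only if the limit exists. Near 0 the derivative is
  nonpositive, so f is antitone there and its values climb, as the argument decreases to 0, to their
  supremum, which may be infinite.\<close>

lemma f_tendsto_f_ext_0: "((\<lambda>v. ereal (f v)) \<longlongrightarrow> f_ext f 0) (at_right 0)"
proof -
  have "eventually (\<lambda>u. deriv f u \<le> 0) (at_right 0)"
    using at_zero by (simp add: filterlim_at_bot)
  then obtain b where b: "b > 0" "\<And>u. 0 < u \<Longrightarrow> u < b \<Longrightarrow> deriv f u \<le> 0"
    unfolding eventually_at_right_field by auto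
  have anti: "f v \<le> f u" if "0 < u" "u \<le> v" "v < b" for u v
  proof -
    have "f v + deriv f v * (u - v) \<le> f u" using f_tangent[of v u] that by auto
    moreover have "deriv f v * (u - v) \<ge> 0" using b(2)[of v] that by (auto simp: mult_nonpos_nonpos)
    ultimately show ?thesis by simp
  qed
  define l where "l = (SUP v\<in>{0<..<b}. ereal (f v))"
  have "((\<lambda>v. ereal (f v)) \<longlongrightarrow> l) (at_right 0)"
  proof (rule increasing_tendsto)
    have "eventually (\<lambda>v. v \<in> {0<..<b}) (at_right 0)" using b(1) by (rule eventually_at_right_real)
    then show "eventually (\<lambda>v. ereal (f v) \<le> l) (at_right 0)"
      by eventually_elim (auto simp: l_def intro: SUP_upper)
    fix y assume "y < l"
    then obtain u where u: "0 < u" "u < b" "y < ereal (f u)"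
      unfolding l_def less_SUP_iff by auto
    have "eventually (\<lambda>v. v \<in> {0<..<u}) (at_right 0)" using u(1) by (rule eventually_at_right_real)
    then show "eventually (\<lambda>v. y < ereal (f v)) (at_right 0)"
    proof eventually_elim
      case (elim v)
      then have "ereal (f u) \<le> ereal (f v)" using anti[of v u] u by simp
      then show ?case using u(3) by (rule less_le_trans[rotated])
    qed
  qed
  moreover have "f_ext f 0 = Lim (at_right 0) (\<lambda>v. ereal (f v))" by (simp add: f_ext_def)
  ultimately show ?thesis by (simp add: tendsto_Lim)
qed

text \<open>Passing to the limit extends the tangent bound to v = 0, which is what allows competing
  policies that give probability 0 to some action.\<close>

lemma f_ext_tangent:
  assumes "u > 0" "v \<ge> 0" shows "ereal (f u + deriv f u * (v - u)) \<le> f_ext f v"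
proof (cases "v = 0")
  case True
  have "((\<lambda>v. ereal (f u + deriv f u * (v - u))) \<longlongrightarrow> ereal (f u + deriv f u * (0 - u))) (at_right 0)"
    by (intro tendsto_intros)
  moreover have "eventually (\<lambda>v. v > (0::real)) (at_right 0)" by (rule eventually_at_right_less)
  then have "eventually (\<lambda>v. ereal (f u + deriv f u * (v - u)) \<le> ereal (f v)) (at_right 0)"
    by eventually_elim (use f_tangent[OF assms(1)] in simp)
  ultimately show ?thesis
    unfolding True by (rule tendsto_le[OF _ f_tendsto_f_ext_0, rotated]) simp
next
  case False
  then show ?thesis using f_tangent[of u v] assms by (simp add: f_ext_def)
qed

end

subsection \<open>Policies induced by rewards\<close>

locale regular_reference = regular_generator +
  fixes \<pi>0 :: "'x \<Rightarrow> 'a::finite \<Rightarrow> real" and \<rho> :: "'x measure"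
  assumes contexts: "prob_space \<rho>" "space \<rho> = UNIV"
    and reference: "policy \<rho> \<pi>0" "\<And>x a. \<pi>0 x a > 0"
begin

section \<open>Existence, uniqueness and shift invariance of the normalizing multiplier\<close>

lemma \<pi>0_sum: "(\<Sum>a\<in>UNIV. \<pi>0 x a) = 1"
  using reference by (simp add: policy_def)

lemma \<pi>0_le_1: "\<pi>0 x a \<le> 1"
  using member_le_sum[of a UNIV "\<pi>0 x"] reference(2)[of x] by (simp add: \<pi>0_sum less_imp_le)

definition lam_spec :: "('x \<Rightarrow> 'a \<Rightarrow> real) \<Rightarrow> 'x \<Rightarrow> real \<Rightarrow> bool" where
  "lam_spec r x l \<longleftrightarrow> (\<forall>a. \<eta> * (r x a - l) \<in> dom_h) \<and> (\<Sum>a\<in>UNIV. \<pi>0 x a * h (\<eta> * (r x a - l))) = 1"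

lemma normalizer_less:
  assumes "\<forall>a. \<eta> * (r x a - l) \<in> dom_h" "l < m"
  shows "(\<forall>a. \<eta> * (r x a - m) \<in> dom_h) \<and>
    (\<Sum>a\<in>UNIV. \<pi>0 x a * h (\<eta> * (r x a - m))) < (\<Sum>a\<in>UNIV. \<pi>0 x a * h (\<eta> * (r x a - l)))"
proof -
  have less: "\<eta> * (r x a - m) < \<eta> * (r x a - l)" for a using assms eta by simp
  have dom: "\<eta> * (r x a - m) \<in> dom_h" for a
    by (rule dom_h_downward[OF assms(1)[rule_format] less_imp_le[OF less]])
  then show ?thesis
    using h_less[OF dom _ less] assms reference(2) by (auto intro!: sum_strict_mono)
qed

lemma lam_spec_unique: "lam_spec r x l \<Longrightarrow> lam_spec r x m \<Longrightarrow> l = m"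
  using normalizer_less[of r x l m] normalizer_less[of r x m l]
  unfolding lam_spec_def by (cases l m rule: linorder_cases) auto

text \<open>Intermediate value theorem for the normalizing sum, between a multiplier at which one
  action alone already has mass 1 and a multiplier at which no density ratio exceeds 1.\<close>

lemma lam_spec_exists: "\<exists>l. lam_spec r x l"
proof -
  have "Max (range (r x)) \<in> range (r x)" by (rule Max_in) auto
  then obtain b where "Max (range (r x)) = r x b" by (rule imageE)
  then have b: "r x a \<le> r x b" for a
    using Max_ge[of "range (r x)" "r x a"] by simp
  \<comment> \<open>b is an action of largest reward. At \<open>l0\<close> its term equals
    \<open>\<pi>0 x b\<close> times \<open>1 / \<pi>0 x b\<close>, hence 1; at \<open>l1\<close> the
    largest argument is \<open>deriv f 1\<close>, so every value of \<open>h\<close> is at most 1.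
    Maximality of b also keeps all arguments in \<open>dom_h\<close> from \<open>l0\<close>
    onwards.\<close>
  define l0 where "l0 = r x b - deriv f (1 / \<pi>0 x b) / \<eta>"
  define l1 where "l1 = r x b - deriv f 1 / \<eta>"
  define N where "N l = (\<Sum>a\<in>UNIV. \<pi>0 x a * h (\<eta> * (r x a - l)))" for l
  have "deriv f 1 \<le> deriv f (1 / \<pi>0 x b)"
    using f'_strict_mono[of 1 "1 / \<pi>0 x b"] \<pi>0_le_1[of x b] reference(2)[of x b]
    by (cases "\<pi>0 x b = 1") auto
  then have le: "l0 \<le> l1" using eta by (simp add: l0_def l1_def divide_right_mono)
  have top: "\<eta> * (r x b - l0) = deriv f (1 / \<pi>0 x b)" using eta by (simp add: l0_def)
  have dom: "\<eta> * (r x a - l) \<in> dom_h" if "l0 \<le> l" for a l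
  proof (rule dom_h_downward)
    show "\<eta> * (r x b - l0) \<in> dom_h" using top reference(2)[of x b] by simp
    show "\<eta> * (r x a - l) \<le> \<eta> * (r x b - l0)" using b[of a] that eta by (intro mult_left_mono) auto
  qed
  have "1 \<le> N l0"
  proof -
    have "\<pi>0 x b * h (\<eta> * (r x b - l0)) = 1"
      using reference(2)[of x b] by (simp add: top h_f')
    moreover have "\<pi>0 x b * h (\<eta> * (r x b - l0)) \<le> N l0"
      unfolding N_def by (rule member_le_sum) (use reference(2) h_pos dom in \<open>auto intro!: mult_nonneg_nonneg less_imp_le\<close>)
    ultimately show ?thesis by simp
  qed
  moreover have "N l1 \<le> 1"
  proof -
    have "h (\<eta> * (r x a - l1)) \<le> 1" for a
    proof -
      have "\<eta> * (r x a - l1) \<le> \<eta> * (r x b - l1)" using b[of a] eta by (intro mult_left_mono) auto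
      also have "\<dots> = deriv f 1" using eta by (simp add: l1_def)
      finally show ?thesis using h_le[OF dom[OF le], of "deriv f 1" a] h_f'[of 1] by auto
    qed
    then have "N l1 \<le> (\<Sum>a\<in>UNIV. \<pi>0 x a * 1)"
      unfolding N_def by (intro sum_mono mult_left_mono) (auto simp: less_imp_le reference(2))
    then show ?thesis by (simp add: \<pi>0_sum)
  qed
  moreover have "continuous_on {l0..l1} N"
    unfolding N_def
    by (intro continuous_intros continuous_on_compose2[OF h_continuous]) (use dom in auto)
  ultimately obtain l where "l0 \<le> l" "N l = 1"
    using IVT2'[of N l1 1 l0] le by blast
  then show ?thesis using dom unfolding lam_spec_def N_def by blast
qed

lemma lam_eq: "lam_spec r x l \<Longrightarrow> lam f \<eta> \<pi>0 r x = l"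
  unfolding lam_def lam_spec_def[symmetric] by (rule the_equality) (auto intro: lam_spec_unique)

lemma lam_spec_lam: "lam_spec r x (lam f \<eta> \<pi>0 r x)"
  using lam_spec_exists[of r x] lam_eq by metis

lemma lam_dom: "\<eta> * (r x a - lam f \<eta> \<pi>0 r x) \<in> dom_h"
  using lam_spec_lam unfolding lam_spec_def by blast

lemma reward_policy_sum: "(\<Sum>a\<in>UNIV. reward_policy f \<eta> \<pi>0 r x a) = 1"
  using lam_spec_lam[of r x] unfolding lam_spec_def reward_policy_def by blast

lemma reward_policy_pos: "reward_policy f \<eta> \<pi>0 r x a > 0"
  unfolding reward_policy_def by (intro mult_pos_pos reference h_pos lam_dom)

text \<open>The multiplier is given only by a definite description. Strict monotonicity of the
  normalizing sum rewrites its sublevel sets as explicit conditions on \<open>r\<close> and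
  \<open>\<pi>0\<close>, and these make it measurable.\<close>

lemma lam_le_iff:
  "lam f \<eta> \<pi>0 r x \<le> c \<longleftrightarrow> (\<forall>a. \<eta> * (r x a - c) \<in> dom_h) \<and>
     (\<Sum>a\<in>UNIV. \<pi>0 x a * h_total (\<eta> * (r x a - c))) \<le> 1" (is "?l \<longleftrightarrow> ?r")
proof -
  let ?l' = "lam f \<eta> \<pi>0 r x"
  have spec: "\<forall>a. \<eta> * (r x a - ?l') \<in> dom_h" "(\<Sum>a\<in>UNIV. \<pi>0 x a * h (\<eta> * (r x a - ?l'))) = 1"
    using lam_spec_lam[of r x] by (auto simp: lam_spec_def)
  show ?thesis
  proof
    assume ?l
    then show ?r using normalizer_less[of r x ?l' c] spec 
      by (cases "?l' = c") (auto simp: h_total_def)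
  next
    assume ?r
    then show ?l using normalizer_less[of r x c ?l'] spec by (force simp: h_total_def)
  qed
qed

text \<open>Adding a constant to the reward in one context raises the multiplier by the same
  constant, so the argument of \<open>h\<close>, and with it the induced policy, depends on reward
  differences only.\<close>

lemma lam_shift:
  assumes "\<And>a b. r x a - r x b = r' x a - r' x b"
  shows "r x a - lam f \<eta> \<pi>0 r x = r' x a - lam f \<eta> \<pi>0 r' x"
proof -
  have eq: "r x b - (lam f \<eta> \<pi>0 r' x + (r x a - r' x a)) = r' x b - lam f \<eta> \<pi>0 r' x" for b
    using assms[of b a] by simp
  have "lam_spec r x (lam f \<eta> \<pi>0 r' x + (r x a - r' x a))"
    using lam_spec_lam[of r' x] unfolding lam_spec_def eq .
  then show ?thesis by (simp add: lam_eq)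
qed

section \<open>Measurability in the context of the quantities induced by a reward\<close>

context
  fixes r :: "'x \<Rightarrow> 'a \<Rightarrow> real"
  assumes r [measurable]: "\<And>a. (\<lambda>x. r x a) \<in> borel_measurable \<rho>"
begin

lemma \<pi>0_borel [measurable]: "(\<lambda>x. \<pi>0 x a) \<in> borel_measurable \<rho>"
  using reference by (simp add: policy_def)

lemma lam_borel [measurable]: "lam f \<eta> \<pi>0 r \<in> borel_measurable \<rho>"
proof -
  note dom_h_borel[measurable]
  show ?thesis unfolding borel_measurable_iff_le lam_le_iff by measurable
qed

lemma reward_policy_borel [measurable]: "(\<lambda>x. reward_policy f \<eta> \<pi>0 r x a) \<in> borel_measurable \<rho>"
proof -
  have "reward_policy f \<eta> \<pi>0 r x a = \<pi>0 x a * h_total (\<eta> * (r x a - lam f \<eta> \<pi>0 r x))" for x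
    by (simp add: reward_policy_def h_total_def lam_dom)
  then show ?thesis by simp
qed

lemma deriv_h_lam_borel [measurable]:
  "(\<lambda>x. deriv h (\<eta> * (r x a - lam f \<eta> \<pi>0 r x))) \<in> borel_measurable \<rho>"
proof -
  have "deriv h (\<eta> * (r x a - lam f \<eta> \<pi>0 r x)) = deriv_h_total (\<eta> * (r x a - lam f \<eta> \<pi>0 r x))" for x
    by (simp add: deriv_h_total_def lam_dom)
  then show ?thesis by simp
qed

lemma policy_reward_policy: "policy \<rho> (reward_policy f \<eta> \<pi>0 r)"
  unfolding policy_def using reward_policy_pos reward_policy_sum by (auto intro: less_imp_le)

lemma T_bar_borel [measurable]: "T_bar f \<eta> \<pi>0 r \<in> borel_measurable \<rho>"
  unfolding T_bar_def[abs_def] by measurable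

lemma deriv_policy_borel [measurable]: "(\<lambda>x. deriv_policy f \<eta> \<pi>0 r x a) \<in> borel_measurable \<rho>"
  unfolding deriv_policy_def by measurable

lemma Z_plus_borel [measurable]: "Z_plus f \<eta> \<pi>0 r \<in> borel_measurable \<rho>"
  unfolding Z_plus_def[abs_def] by measurable

lemma Z_minus_borel [measurable]: "Z_minus f \<eta> \<pi>0 r \<in> borel_measurable \<rho>"
  unfolding Z_minus_def[abs_def] by measurable

lemma pair_prob_borel [measurable]: "(\<lambda>x. pair_prob f \<eta> \<pi>0 r x a b) \<in> borel_measurable \<rho>"
  unfolding pair_prob_def mix_prob_def policy_plus_def policy_minus_def by measurable

lemma raw_weight_borel [measurable]: "raw_weight f \<eta> \<pi>0 r \<in> borel_measurable \<rho>"
  unfolding raw_weight_def[abs_def] by measurable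

end

section \<open>Positivity, normalization and bounds for the sampling laws and weights\<close>

lemma T_bar_pos: "T_bar f \<eta> \<pi>0 r x > 0"
  unfolding T_bar_def by (intro sum_pos mult_pos_pos reference deriv_h_pos lam_dom) auto

lemma deriv_policy_pos: "deriv_policy f \<eta> \<pi>0 r x a > 0"
  unfolding deriv_policy_def
  by (intro divide_pos_pos mult_pos_pos reference deriv_h_pos lam_dom T_bar_pos)

lemma deriv_policy_sum: "(\<Sum>a\<in>UNIV. deriv_policy f \<eta> \<pi>0 r x a) = 1"
  unfolding deriv_policy_def sum_divide_distrib[symmetric] T_bar_def[symmetric]
  using T_bar_pos[of r x] by simp

lemma Z_plus_pos: "Z_plus f \<eta> \<pi>0 r x > 0"
  unfolding Z_plus_def by (intro sum_pos mult_pos_pos deriv_policy_pos) auto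

lemma Z_minus_pos: "Z_minus f \<eta> \<pi>0 r x > 0"
  unfolding Z_minus_def by (intro sum_pos mult_pos_pos deriv_policy_pos) auto

lemma Z_plus_le: 
  assumes "\<And>a. r x a \<le> 1" shows "Z_plus f \<eta> \<pi>0 r x \<le> exp 1"
proof -
  have "Z_plus f \<eta> \<pi>0 r x \<le> (\<Sum>a\<in>UNIV. deriv_policy f \<eta> \<pi>0 r x a * exp 1)"
    unfolding Z_plus_def using assms
    by (intro sum_mono mult_left_mono) (auto intro: less_imp_le deriv_policy_pos)
  then show ?thesis by (simp add: sum_distrib_right[symmetric] deriv_policy_sum)
qed

lemma Z_minus_le: 
  assumes "\<And>a. 0 \<le> r x a" shows "Z_minus f \<eta> \<pi>0 r x \<le> 1"
proof -
  have "Z_minus f \<eta> \<pi>0 r x \<le> (\<Sum>a\<in>UNIV. deriv_policy f \<eta> \<pi>0 r x a * 1)"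
    unfolding Z_minus_def using assms
    by (intro sum_mono mult_left_mono) (auto intro: less_imp_le deriv_policy_pos)
  then show ?thesis by (simp add: deriv_policy_sum)
qed

lemma policy_plus_pos: "policy_plus f \<eta> \<pi>0 r x a > 0"
  unfolding policy_plus_def by (intro divide_pos_pos mult_pos_pos deriv_policy_pos Z_plus_pos) auto

lemma policy_minus_pos: "policy_minus f \<eta> \<pi>0 r x a > 0"
  unfolding policy_minus_def by (intro divide_pos_pos mult_pos_pos deriv_policy_pos Z_minus_pos) auto

lemma policy_plus_sum: "(\<Sum>a\<in>UNIV. policy_plus f \<eta> \<pi>0 r x a) = 1"
  unfolding policy_plus_def sum_divide_distrib[symmetric] Z_plus_def[symmetric]
  using Z_plus_pos[of r x] by simp

lemma policy_minus_sum: "(\<Sum>a\<in>UNIV. policy_minus f \<eta> \<pi>0 r x a) = 1"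
  unfolding policy_minus_def sum_divide_distrib[symmetric] Z_minus_def[symmetric]
  using Z_minus_pos[of r x] by simp

lemma mix_prob_bounds: "0 < mix_prob f \<eta> \<pi>0 r x" "mix_prob f \<eta> \<pi>0 r x < 1"
  using mult_pos_pos[OF Z_plus_pos Z_minus_pos, of r x r x] by (auto simp: mix_prob_def)

text \<open>Full support: every ordered pair of actions can be drawn at every parameter. This is
  what lets the data separate any two rewards with different gaps.\<close>

lemma pair_prob_pos: "pair_prob f \<eta> \<pi>0 r x a b > 0"
  unfolding pair_prob_def using mix_prob_bounds[of r x]
  by (intro add_pos_pos mult_pos_pos deriv_policy_pos policy_plus_pos policy_minus_pos) auto

lemma pair_prob_sum: "(\<Sum>a\<in>UNIV. \<Sum>b\<in>UNIV. pair_prob f \<eta> \<pi>0 r x a b) = 1"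
  by (simp add: pair_prob_def sum.distrib sum_distrib_left[symmetric] deriv_policy_sum
      policy_plus_sum policy_minus_sum)

lemma pair_prob_le_1: "pair_prob f \<eta> \<pi>0 r x a b \<le> 1"
proof -
  have "pair_prob f \<eta> \<pi>0 r x a b \<le> (\<Sum>b\<in>UNIV. pair_prob f \<eta> \<pi>0 r x a b)"
    by (rule member_le_sum) (auto intro: less_imp_le pair_prob_pos)
  also have "\<dots> \<le> (\<Sum>a\<in>UNIV. \<Sum>b\<in>UNIV. pair_prob f \<eta> \<pi>0 r x a b)"
    by (rule member_le_sum) (auto intro: less_imp_le pair_prob_pos sum_nonneg)
  finally show ?thesis by (simp add: pair_prob_sum)
qed

lemma raw_weight_pos: "raw_weight f \<eta> \<pi>0 r x > 0"
  unfolding raw_weight_def by (intro add_pos_pos mult_pos_pos T_bar_pos Z_plus_pos Z_minus_pos)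

text \<open>For rewards in [0, 1] the product of the two partition functions is at most exp 1, so a
  uniform bound on \<open>T_bar\<close> controls the weight.\<close>

lemma raw_weight_le:
  assumes "\<And>a. r x a \<in> {0..1}"
  shows "raw_weight f \<eta> \<pi>0 r x \<le> (1 + exp 1) * T_bar f \<eta> \<pi>0 r x"
proof -
  have "Z_plus f \<eta> \<pi>0 r x * Z_minus f \<eta> \<pi>0 r x \<le> exp 1 * 1"
    using Z_plus_pos[of r x] Z_minus_pos[of r x] assms
    by (intro mult_mono Z_plus_le Z_minus_le) auto
  from mult_right_mono[OF this less_imp_le[OF T_bar_pos[of r x]]]
  show ?thesis by (simp add: raw_weight_def algebra_simps)
qed

subsection \<open>Optimality and the value gap\<close>

lemma f_div_real:
  assumes "\<And>a. \<pi> x a > 0"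
  shows "f_div f \<pi> \<pi>0 x = ereal (\<Sum>a\<in>UNIV. \<pi>0 x a * f (\<pi> x a / \<pi>0 x a))"
proof -
  have "ereal (\<pi>0 x a) * f_ext f (\<pi> x a / \<pi>0 x a) = ereal (\<pi>0 x a * f (\<pi> x a / \<pi>0 x a))" for a
    using assms[of a] reference(2)[of x a] by (simp add: f_ext_def)
  then show ?thesis by (simp add: f_div_def)
qed

text \<open>Real-valued form of the integrand of \<open>J_obj\<close>; the two agree for policies
  that give every action positive probability.\<close>

definition gain :: "('x \<Rightarrow> 'a \<Rightarrow> real) \<Rightarrow> ('x \<Rightarrow> 'a \<Rightarrow> real) \<Rightarrow> 'x \<Rightarrow> real" where
  "gain r \<pi> x = (\<Sum>a\<in>UNIV. \<pi> x a * r x a) - 1 / \<eta> * (\<Sum>a\<in>UNIV. \<pi>0 x a * f (\<pi> x a / \<pi>0 x a))"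

text \<open>The divergence is bounded below by its tangents at the density ratios of the reward
  policy. Their slopes are \<eta> times (reward minus multiplier), so the linearized objective takes
  the same value at every competitor.\<close>

lemma reward_policy_optimal:
  assumes "\<And>a. \<pi> x a \<ge> 0" "(\<Sum>a\<in>UNIV. \<pi> x a) = 1"
  shows "ereal (\<Sum>a\<in>UNIV. \<pi> x a * r x a) - ereal (1 / \<eta>) * f_div f \<pi> \<pi>0 x
           \<le> ereal (gain r (reward_policy f \<eta> \<pi>0 r) x)"
proof -
  define p where "p = reward_policy f \<eta> \<pi>0 r x"
  define u where "u a = h (\<eta> * (r x a - lam f \<eta> \<pi>0 r x))" for a
  \<comment> \<open>L is the linearized divergence of the competitor. The terms with the multiplier
    cancel because both policies sum to 1, and the reward terms cancel against the expected reward
    of the competitor.\<close>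
  define L where "L = (\<Sum>a\<in>UNIV. \<pi>0 x a * (f (u a) + deriv f (u a) * (\<pi> x a / \<pi>0 x a - u a)))"
  have pu: "p a = \<pi>0 x a * u a" for a by (simp add: p_def reward_policy_def u_def)
  have u_pos: "u a > 0" for a unfolding u_def by (rule h_pos[OF lam_dom])
  have f'u: "deriv f (u a) = \<eta> * (r x a - lam f \<eta> \<pi>0 r x)" for a
    unfolding u_def by (rule f'_h[OF lam_dom])
  have sum_p: "(\<Sum>a\<in>UNIV. p a) = 1" using reward_policy_sum[of r x] by (simp add: p_def)
  have "ereal L = (\<Sum>a\<in>UNIV. ereal (\<pi>0 x a) * ereal (f (u a) + deriv f (u a) * (\<pi> x a / \<pi>0 x a - u a)))"
    by (simp add: L_def)
  also have "\<dots> \<le> f_div f \<pi> \<pi>0 x"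
    unfolding f_div_def
    by (intro sum_mono ereal_mult_left_mono f_ext_tangent u_pos)
      (use assms reference(2)[of x] in \<open>auto intro: less_imp_le divide_nonneg_pos\<close>)
  finally have "ereal (1 / \<eta>) * ereal L \<le> ereal (1 / \<eta>) * f_div f \<pi> \<pi>0 x"
    using eta by (intro ereal_mult_left_mono) auto
  then have "ereal (\<Sum>a\<in>UNIV. \<pi> x a * r x a) - ereal (1 / \<eta>) * f_div f \<pi> \<pi>0 x
      \<le> ereal (\<Sum>a\<in>UNIV. \<pi> x a * r x a) - ereal (1 / \<eta>) * ereal L"
    by (intro ereal_minus_mono) auto
  also have "\<dots> = ereal ((\<Sum>a\<in>UNIV. \<pi> x a * r x a) - L / \<eta>)" by simp
  also have "(\<Sum>a\<in>UNIV. \<pi> x a * r x a) - L / \<eta> = gain r (reward_policy f \<eta> \<pi>0 r) x"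
  proof -
    let ?l = "lam f \<eta> \<pi>0 r x"
    have "\<pi>0 x a * (f (u a) + deriv f (u a) * (\<pi> x a / \<pi>0 x a - u a))
        = \<pi>0 x a * f (p a / \<pi>0 x a) + \<eta> * (\<pi> x a * r x a - p a * r x a - ?l * \<pi> x a + ?l * p a)" for a
      using reference(2)[of x a] by (simp add: f'u pu field_simps)
    then have "L = (\<Sum>a\<in>UNIV. \<pi>0 x a * f (p a / \<pi>0 x a))
        + \<eta> * ((\<Sum>a\<in>UNIV. \<pi> x a * r x a) - (\<Sum>a\<in>UNIV. p a * r x a) - ?l * (\<Sum>a\<in>UNIV. \<pi> x a) + ?l * (\<Sum>a\<in>UNIV. p a))"
      by (simp add: L_def sum.distrib sum_subtractf sum_distrib_left[symmetric])
    then show ?thesis using eta by (simp add: assms sum_p gain_def p_def[symmetric] field_simps)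
  qed
  finally show ?thesis .
qed

lemma objective_reward_policy:
  "J_obj f \<eta> \<pi>0 \<rho> rstar (reward_policy f \<eta> \<pi>0 r)
     = expectation_ereal \<rho> (\<lambda>x. ereal (gain rstar (reward_policy f \<eta> \<pi>0 r) x))"
  unfolding J_obj_def by (simp add: f_div_real[OF reward_policy_pos] gain_def)

lemma expectation_ereal_mono:
  assumes "\<And>x. g x \<le> k x" shows "expectation_ereal \<rho> g \<le> expectation_ereal \<rho> k"
  unfolding expectation_ereal_def using assms
  by (intro ereal_minus_mono) (auto intro!: nn_integral_mono e2ennreal_mono simp: less_eq_ennreal.rep_eq[symmetric])

text \<open>\<open>arg_max\<close> selects some maximizer. The reward policy of \<open>rstar\<close>
  is itself one, by the pointwise bound, and all maximizers share one value, so the selection does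
  not matter.\<close>

lemma J_obj_opt_policy:
  assumes "\<And>a. (\<lambda>x. rstar x a) \<in> borel_measurable \<rho>"
  shows "J_obj f \<eta> \<pi>0 \<rho> rstar (opt_policy f \<eta> \<pi>0 \<rho> rstar)
     = J_obj f \<eta> \<pi>0 \<rho> rstar (reward_policy f \<eta> \<pi>0 rstar)"
proof -
  let ?J = "J_obj f \<eta> \<pi>0 \<rho> rstar" and ?p = "reward_policy f \<eta> \<pi>0 rstar"
  have le: "?J \<pi> \<le> ?J ?p" if "policy \<rho> \<pi>" for \<pi>
    unfolding objective_reward_policy unfolding J_obj_def
    by (intro expectation_ereal_mono reward_policy_optimal) (use that in \<open>auto simp: policy_def\<close>)
  have "is_arg_max ?J (policy \<rho>) ?p"
    using policy_reward_policy[OF assms] le by (auto simp: is_arg_max_linorder)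
  then have "is_arg_max ?J (policy \<rho>) (opt_policy f \<eta> \<pi>0 \<rho> rstar)"
    unfolding opt_policy_def arg_max_def by (rule someI[of "is_arg_max ?J (policy \<rho>)"])
  then show ?thesis
    using le policy_reward_policy[OF assms] by (auto simp: is_arg_max_linorder intro: antisym)
qed

text \<open>The divergence of the reward policy is nonnegative by the tangent at 1, and the
  regularization term is at most 1 because the policy must beat the reference in its own objective.
  Finite objectives follow, even with an unbounded generator.\<close>

lemma gain_bounds:
  assumes r: "\<And>a. r x a \<in> {0..1}" and rstar: "\<And>a. rstar x a \<in> {0..1}"
  shows "gain rstar (reward_policy f \<eta> \<pi>0 r) x \<in> {-1..1}"
proof -
  let ?p = "reward_policy f \<eta> \<pi>0 r x"
  define D where "D = (\<Sum>a\<in>UNIV. \<pi>0 x a * f (?p a / \<pi>0 x a))"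
  have avg: "(\<Sum>a\<in>UNIV. ?p a * s a) \<in> {0..1}" if "\<And>a. s a \<in> {0..1}" for s
  proof -
    have "(\<Sum>a\<in>UNIV. ?p a * s a) \<le> (\<Sum>a\<in>UNIV. ?p a * 1)"
      by (intro sum_mono mult_left_mono) (use that reward_policy_pos in \<open>auto intro: less_imp_le\<close>)
    moreover have "(\<Sum>a\<in>UNIV. ?p a * s a) \<ge> 0"
      by (intro sum_nonneg mult_nonneg_nonneg) (use that reward_policy_pos in \<open>auto intro: less_imp_le\<close>)
    ultimately show ?thesis using reward_policy_sum[of r x] by simp
  qed
  have "D \<ge> 0"
  proof -
    have "\<pi>0 x a * (deriv f 1 * (?p a / \<pi>0 x a - 1)) \<le> \<pi>0 x a * f (?p a / \<pi>0 x a)" for a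
      using f_tangent[of 1 "?p a / \<pi>0 x a"] f_1 reference(2)[of x a] reward_policy_pos[of r x a]
      by (intro mult_left_mono) auto
    moreover have "\<pi>0 x a * (deriv f 1 * (?p a / \<pi>0 x a - 1)) = deriv f 1 * (?p a - \<pi>0 x a)" for a
      using reference(2)[of x a] by (simp add: field_simps)
    ultimately have "(\<Sum>a\<in>UNIV. deriv f 1 * (?p a - \<pi>0 x a)) \<le> D"
      unfolding D_def by (intro sum_mono) metis
    then show ?thesis
      by (simp add: sum_distrib_left[symmetric] sum_subtractf reward_policy_sum \<pi>0_sum)
  qed
  \<comment> \<open>Optimality is used for the reward \<open>r\<close> that induces the policy, with
    \<open>\<pi>0\<close> as competitor: its divergence vanishes and its expected reward is
    nonnegative.\<close>
  moreover have "D / \<eta> \<le> 1"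
  proof -
    have nonneg: "0 \<le> (\<Sum>a\<in>UNIV. \<pi>0 x a * r x a)"
      by (intro sum_nonneg mult_nonneg_nonneg) (use r reference(2) in \<open>auto intro: less_imp_le\<close>)
    have "f_div f \<pi>0 \<pi>0 x = 0"
      using f_div_real[of \<pi>0 x] reference(2)[of x] f_1 by (simp add: less_imp_neq[THEN not_sym])
    then have "ereal (\<Sum>a\<in>UNIV. \<pi>0 x a * r x a) \<le> ereal (gain r (reward_policy f \<eta> \<pi>0 r) x)"
      using reward_policy_optimal[of \<pi>0 x r] \<pi>0_sum reference(2) by (simp add: less_imp_le)
    then show ?thesis using nonneg avg[of "r x"] r by (simp add: gain_def D_def[symmetric])
  qed
  moreover have "D / \<eta> \<ge> 0" using \<open>D \<ge> 0\<close> eta by simp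
  ultimately show ?thesis
    using avg[of "rstar x"] rstar by (simp add: gain_def D_def[symmetric])
qed

lemma expectation_ereal_finite:
  assumes "\<And>x. g x \<in> {-1..1::real}"
  shows "\<bar>expectation_ereal \<rho> (\<lambda>x. ereal (g x))\<bar> \<noteq> \<infinity>"
proof -
  interpret prob_space \<rho> by (rule contexts)
  have *: "\<exists>c\<ge>0. (\<integral>\<^sup>+x. ennreal (k x) \<partial>\<rho>) = ennreal c" if "\<And>x. k x \<le> 1" for k
  proof -
    have "(\<integral>\<^sup>+x. ennreal (k x) \<partial>\<rho>) \<le> (\<integral>\<^sup>+x. 1 \<partial>\<rho>)"
      using that by (intro nn_integral_mono) (auto simp: ennreal_le_1)
    also have "\<dots> < top" by (simp add: emeasure_space_1)
    finally show ?thesis by (cases "\<integral>\<^sup>+x. ennreal (k x) \<partial>\<rho>") auto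
  qed
  have "g x \<le> 1" "- g x \<le> 1" for x using assms[of x] by auto
  then obtain c d where "c \<ge> 0" "d \<ge> 0" "(\<integral>\<^sup>+x. ennreal (g x) \<partial>\<rho>) = ennreal c"
      "(\<integral>\<^sup>+x. ennreal (- g x) \<partial>\<rho>) = ennreal d"
    using *[of g] *[of "\<lambda>x. - g x"] by auto
  then show ?thesis
    by (simp add: expectation_ereal_def)
qed

lemma J_obj_finite:
  assumes "\<And>x a. r x a \<in> {0..1}" "\<And>x a. rstar x a \<in> {0..1}"
  shows "\<bar>J_obj f \<eta> \<pi>0 \<rho> rstar (reward_policy f \<eta> \<pi>0 r)\<bar> \<noteq> \<infinity>"
  unfolding objective_reward_policy
  by (intro expectation_ereal_finite gain_bounds assms)

text \<open>The identifiable relation between rewards: preferences reveal only differences, and only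
  on contexts outside a null set. By shift invariance of the multiplier it still determines the
  value of the induced policy.\<close>

definition same_gaps :: "('x \<Rightarrow> 'a \<Rightarrow> real) \<Rightarrow> ('x \<Rightarrow> 'a \<Rightarrow> real) \<Rightarrow> bool" where
  "same_gaps r r' \<longleftrightarrow> (AE x in \<rho>. \<forall>a b. r x a - r x b = r' x a - r' x b)"

lemma J_obj_same_gaps:
  assumes "same_gaps r r'"
  shows "J_obj f \<eta> \<pi>0 \<rho> rstar (reward_policy f \<eta> \<pi>0 r) = J_obj f \<eta> \<pi>0 \<rho> rstar (reward_policy f \<eta> \<pi>0 r')"
proof -
  have "AE x in \<rho>. gain rstar (reward_policy f \<eta> \<pi>0 r) x = gain rstar (reward_policy f \<eta> \<pi>0 r') x"
    using assms unfolding same_gaps_def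
  proof eventually_elim
    case (elim x)
    then have "r x a - lam f \<eta> \<pi>0 r x = r' x a - lam f \<eta> \<pi>0 r' x" for a by (intro lam_shift) auto
    then show ?case by (simp add: gain_def reward_policy_def)
  qed
  then show ?thesis
    unfolding objective_reward_policy expectation_ereal_def
    by (intro arg_cong2[where f = "(-)"] arg_cong[where f = enn2ereal] nn_integral_cong_AE) (auto elim: AE_mp)
qed

subsection \<open>Contraction of the tempered likelihood ratio in one round\<close>

text \<open>Conditional law of the two actions and the preference bit given the context, when the
  pair is sampled at the reward \<open>r\<close>.\<close>

definition step_prob :: "('x \<Rightarrow> 'a \<Rightarrow> real) \<Rightarrow> ('x \<Rightarrow> 'a \<Rightarrow> real) \<Rightarrow> 'x \<Rightarrow> 'a \<times> 'a \<times> bool \<Rightarrow> real" where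
  "step_prob rstar r x = (\<lambda>(a, b, y). pair_prob f \<eta> \<pi>0 r x a b * pref_prob rstar x a b y)"

lemma pref_prob_bounds: "0 \<le> pref_prob s x a b y" "pref_prob s x a b y \<le> 1"
  using logistic_bounds[of "s x a - s x b"] by (auto simp: pref_prob_def)

lemma step_prob_bounds: "0 \<le> step_prob s r x p" "step_prob s r x p \<le> 1"
proof -
  obtain a b y where p: "p = (a, b, y)" by (cases p)
  show "0 \<le> step_prob s r x p"
    using mult_nonneg_nonneg[OF less_imp_le[OF pair_prob_pos] pref_prob_bounds(1)]
    by (simp add: p step_prob_def)
  show "step_prob s r x p \<le> 1"
    using mult_mono[OF pair_prob_le_1[of r x a b] pref_prob_bounds(2)[of s x a b y] zero_le_one pref_prob_bounds(1)]
    by (simp add: p step_prob_def)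
qed

text \<open>An average of affinities, each at most 1, with positive weights summing to 1: a total of
  1 forces every affinity to be 1. The sampling reward \<open>r\<close> and the tested reward
  \<open>r'\<close> are unrelated, so the statement covers rounds sampled at any parameter.\<close>

lemma tilted_step_mean:
  assumes "0 < \<tau> x" "\<tau> x < 1"
  shows "(\<Sum>p\<in>UNIV. step_prob s r x p * tilt \<tau> r' s x p) \<le> 1" (is "?S \<le> 1")
    and "(\<Sum>p\<in>UNIV. step_prob s r x p * tilt \<tau> r' s x p) = 1 \<Longrightarrow> r' x a - r' x b = s x a - s x b"
proof -
  let ?K = "\<lambda>a b. \<Sum>y\<in>UNIV. pref_prob s x a b y * tilt \<tau> r' s x (a, b, y)"
  let ?p = "pair_prob f \<eta> \<pi>0 r x"
  have "?S = (\<Sum>a\<in>UNIV. \<Sum>b\<in>UNIV. \<Sum>y\<in>UNIV. step_prob s r x (a, b, y) * tilt \<tau> r' s x (a, b, y))"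
    by (simp add: UNIV_Times_UNIV[symmetric] sum.cartesian_product' del: UNIV_Times_UNIV)
  also have "\<dots> = (\<Sum>a\<in>UNIV. \<Sum>b\<in>UNIV. ?p a b * ?K a b)"
    by (simp add: step_prob_def sum_distrib_left mult.assoc)
  finally have S: "?S = (\<Sum>a\<in>UNIV. \<Sum>b\<in>UNIV. ?p a b * ?K a b)" .
  have gap: "0 \<le> ?p a b * (1 - ?K a b)" for a b
    using tilt_mean(1)[of \<tau> x s a b r'] pair_prob_pos[of r x a b] assms by simp
  have diff: "1 - ?S = (\<Sum>a\<in>UNIV. \<Sum>b\<in>UNIV. ?p a b * (1 - ?K a b))"
    unfolding S by (simp add: right_diff_distrib sum_subtractf pair_prob_sum)
  have "0 \<le> 1 - ?S" unfolding diff by (intro sum_nonneg gap)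
  then show "?S \<le> 1" by simp
  assume "?S = 1"
  then have "(\<Sum>a\<in>UNIV. \<Sum>b\<in>UNIV. ?p a b * (1 - ?K a b)) = 0" using diff by simp
  then have "?p a b * (1 - ?K a b) = 0"
    by (simp add: sum_nonneg_eq_0_iff gap sum_nonneg)
  then have "?K a b = 1" using pair_prob_pos[of r x a b] by simp
  then show "r' x a - r' x b = s x a - s x b" by (rule tilt_mean(2)[of \<tau> x, OF assms])
qed

lemma tilt_borel [measurable]:
  assumes [measurable]: "\<tau> \<in> borel_measurable \<rho>" "\<And>a. (\<lambda>x. r x a) \<in> borel_measurable \<rho>"
    "\<And>a. (\<lambda>x. s x a) \<in> borel_measurable \<rho>"
  shows "(\<lambda>x. tilt \<tau> r s x p) \<in> borel_measurable \<rho>"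
  unfolding tilt_def logistic_def by (cases p) simp

lemma step_prob_borel [measurable]:
  assumes [measurable]: "\<And>a. (\<lambda>x. r x a) \<in> borel_measurable \<rho>" "\<And>a. (\<lambda>x. s x a) \<in> borel_measurable \<rho>"
  shows "(\<lambda>x. step_prob s r x p) \<in> borel_measurable \<rho>"
proof (cases p)
  case (fields a b y)
  then show ?thesis unfolding step_prob_def pref_prob_def logistic_def by (cases y) simp_all
qed

text \<open>The integrand is at most 1, so an integral equal to 1 would make it 1 almost everywhere,
  and then the gaps of the two rewards would agree almost everywhere.\<close>

lemma tilted_step_integral_less_1:
  assumes [measurable]: "\<tau> \<in> borel_measurable \<rho>" "\<And>a. (\<lambda>x. r x a) \<in> borel_measurable \<rho>"
    "\<And>a. (\<lambda>x. s x a) \<in> borel_measurable \<rho>" "\<And>a. (\<lambda>x. r' x a) \<in> borel_measurable \<rho>"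
    and \<tau>: "\<And>x. 0 < \<tau> x" "\<And>x. \<tau> x < 1"
    and "\<not> same_gaps r' s"
  shows "(\<integral>\<^sup>+x. ennreal (\<Sum>p\<in>UNIV. step_prob s r x p * tilt \<tau> r' s x p) \<partial>\<rho>) < 1"
proof -
  interpret prob_space \<rho> by (rule contexts)
  let ?G = "\<lambda>x. \<Sum>p\<in>UNIV. step_prob s r x p * tilt \<tau> r' s x p"
  have nonneg: "?G x \<ge> 0" for x
    by (intro sum_nonneg mult_nonneg_nonneg step_prob_bounds) (auto simp: tilt_def split: prod.split)
  have le: "?G x \<le> 1" for x using tilted_step_mean(1) \<tau> by blast
  have int: "integrable \<rho> ?G"
    by (rule integrable_const_bound[where B = 1]) (use le nonneg in auto)
  have "integral\<^sup>L \<rho> ?G \<le> 1" using integral_le_const[OF int] le by simp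
  moreover have "integral\<^sup>L \<rho> ?G \<noteq> 1"
  proof
    assume "integral\<^sup>L \<rho> ?G = 1"
    then have "integral\<^sup>L \<rho> (\<lambda>x. 1 - ?G x) = 0" using int by (simp add: prob_space)
    then have "AE x in \<rho>. 1 - ?G x = 0"
      using int le by (subst (asm) integral_nonneg_eq_0_iff_AE) auto
    then have "same_gaps r' s"
      unfolding same_gaps_def
    proof eventually_elim
      case (elim x)
      then show ?case using tilted_step_mean(2)[of \<tau> x s r r'] \<tau> by (metis diff_eq_diff_eq diff_self eq_iff_diff_eq_0)
    qed
    with assms show False by blast
  qed
  ultimately have "integral\<^sup>L \<rho> ?G < 1" by simp
  then show ?thesis using nn_integral_eq_integral[OF int] nonneg by (simp add: ennreal_less_one_iff)
qed

end

subsection \<open>Consistency of the exploration algorithm\<close>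

locale exploration = regular_reference f \<eta> \<pi>0 \<rho>
  for f \<eta> and \<pi>0 :: "'x \<Rightarrow> 'a::finite \<Rightarrow> real" and \<rho> +
  fixes \<Theta> :: "'p set" and r :: "'p \<Rightarrow> 'x \<Rightarrow> 'a \<Rightarrow> real" and rstar :: "'x \<Rightarrow> 'a \<Rightarrow> real" and \<theta>star :: 'p
    and M :: "'w measure" and F :: "nat \<Rightarrow> 'w measure"
    and X :: "nat \<Rightarrow> 'w \<Rightarrow> 'x" and A1 A2 :: "nat \<Rightarrow> 'w \<Rightarrow> 'a" and Y :: "nat \<Rightarrow> 'w \<Rightarrow> bool"
    and \<theta> :: "nat \<Rightarrow> 'w \<Rightarrow> 'p"
  assumes reward_meas: "\<And>\<phi> a. \<phi> \<in> \<Theta> \<Longrightarrow> (\<lambda>x. r \<phi> x a) \<in> borel_measurable \<rho>"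
    and reward_range: "\<And>\<phi> x a. \<phi> \<in> \<Theta> \<Longrightarrow> r \<phi> x a \<in> {0..1}"
    and finite_class: "finite (r ` \<Theta>)"
    and realizable: "\<theta>star \<in> \<Theta>" "r \<theta>star = rstar"
    and run: "exploration_run f \<eta> \<pi>0 \<rho> \<Theta> r rstar M F X A1 A2 Y \<theta>"
begin

definition feedback :: "nat \<Rightarrow> 'w \<Rightarrow> 'a \<times> 'a \<times> bool" where
  "feedback t \<omega> = (A1 t \<omega>, A2 t \<omega>, Y t \<omega>)"

lemma prob_space_M: "prob_space M" using run by (simp add: exploration_run_def)

sublocale M: prob_space M by (rule prob_space_M)

lemma space_F: "space (F t) = space M"
  using run by (auto simp: exploration_run_def filtration_def)

lemma sets_F: "sets (F t) \<subseteq> sets M" using run by (simp add: exploration_run_def)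

lemma measurable_F_le:
  assumes "g \<in> F s \<rightarrow>\<^sub>M N" "s \<le> t" shows "g \<in> F t \<rightarrow>\<^sub>M N"
proof -
  have "sets (F s) \<subseteq> sets (F t)"
    using run assms(2) by (auto simp: exploration_run_def filtration_def)
  then show ?thesis using assms(1) space_F by (auto simp: measurable_def)
qed

lemma measurable_F_M: "g \<in> F t \<rightarrow>\<^sub>M N \<Longrightarrow> g \<in> M \<rightarrow>\<^sub>M N"
  using sets_F[of t] space_F[of t] by (auto simp: measurable_def)

lemma X_measurable: "t \<ge> 1 \<Longrightarrow> X t \<in> F t \<rightarrow>\<^sub>M \<rho>"
  using run by (simp add: exploration_run_def)

lemma feedback_measurable:
  assumes "t \<ge> 1" shows "feedback t \<in> F t \<rightarrow>\<^sub>M count_space UNIV"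
proof -
  have [measurable]: "A1 t \<in> F t \<rightarrow>\<^sub>M count_space UNIV" "A2 t \<in> F t \<rightarrow>\<^sub>M count_space UNIV"
      "Y t \<in> F t \<rightarrow>\<^sub>M count_space UNIV"
    using run assms by (auto simp: exploration_run_def)
  show ?thesis
  proof (rule measurable_count_space_eq2_countable[THEN iffD2, rule_format], safe)
    fix a b y
    have "feedback t -` {(a, b, y)} \<inter> space (F t) = {\<omega>\<in>space (F t). A1 t \<omega> = a \<and> A2 t \<omega> = b \<and> Y t \<omega> = y}"
      by (auto simp: feedback_def)
    also have "\<dots> \<in> sets (F t)" by measurable
    finally show "feedback t -` {(a, b, y)} \<inter> space (F t) \<in> sets (F t)" .
  qed auto
qed

lemma X_measurable_M [measurable]: "X (Suc t) \<in> M \<rightarrow>\<^sub>M \<rho>"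
  by (rule measurable_F_M[OF X_measurable]) simp

lemma feedback_measurable_M [measurable]: "feedback (Suc t) \<in> M \<rightarrow>\<^sub>M count_space UNIV"
  by (rule measurable_F_M[OF feedback_measurable]) simp

lemma \<theta>_measurable: "(\<lambda>\<omega>. r (\<theta> t \<omega>)) \<in> F t \<rightarrow>\<^sub>M count_space (r ` \<Theta>)"
  using run by (simp add: exploration_run_def)

lemma \<theta>_event: "{\<omega>\<in>space M. r (\<theta> t \<omega>) \<in> S} \<in> sets (F t)"
proof -
  have "(\<lambda>\<omega>. r (\<theta> t \<omega>)) -` (S \<inter> r ` \<Theta>) \<inter> space (F t) \<in> sets (F t)"
    by (rule measurable_sets[OF \<theta>_measurable]) auto
  moreover have "(\<lambda>\<omega>. r (\<theta> t \<omega>)) -` (S \<inter> r ` \<Theta>) \<inter> space (F t) = {\<omega>\<in>space M. r (\<theta> t \<omega>) \<in> S}"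
    using measurable_space[OF \<theta>_measurable, of _ t] by (auto simp: space_F)
  ultimately show ?thesis by simp
qed

section \<open>Integration against the conditional law of one round\<close>

lemma class_borel: "\<psi> \<in> r ` \<Theta> \<Longrightarrow> (\<lambda>x. \<psi> x a) \<in> borel_measurable \<rho>"
  using reward_meas by auto

lemma rstar_class: "rstar \<in> r ` \<Theta>" using realizable by blast

text \<open>On an event where the current reward is constantly \<psi>, the inner integral in the
  specification of the run is a constant and comes out of the outer one.\<close>

lemma step_law:
  assumes E: "E \<in> sets (F t)" "E \<subseteq> {\<omega>\<in>space M. r (\<theta> t \<omega>) = \<psi>}" and \<psi>: "\<psi> \<in> r ` \<Theta>"
    and B: "B \<in> sets \<rho>"
  shows "emeasure M {\<omega>\<in>E. X (Suc t) \<omega> \<in> B \<and> feedback (Suc t) \<omega> = p}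
    = emeasure M E * (\<integral>\<^sup>+x. ennreal (step_prob rstar \<psi> x p) * indicator B x \<partial>\<rho>)"
proof -
  interpret \<rho>: prob_space \<rho> by (rule contexts)
  obtain a b y where p: "p = (a, b, y)" by (cases p)
  define c where "c = (LINT x:B|\<rho>. step_prob rstar \<psi> x p)"
  note [measurable] = step_prob_borel[OF class_borel[OF \<psi>] class_borel[OF rstar_class]] B
  have int: "integrable \<rho> (\<lambda>x. indicator B x * step_prob rstar \<psi> x p)"
    by (rule \<rho>.integrable_const_bound[where B = 1])
      (use step_prob_bounds[of rstar \<psi>] in \<open>auto simp: indicator_def\<close>)
  have "measure M {\<omega>\<in>E. X (Suc t) \<omega> \<in> B \<and> feedback (Suc t) \<omega> = p}
      = (LINT \<omega>:E|M. (LINT x:B|\<rho>. pair_prob f \<eta> \<pi>0 (r (\<theta> t \<omega>)) x a b * pref_prob rstar x a b y))"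
    using run E(1) B by (simp add: exploration_run_def feedback_def p)
  also have "\<dots> = (LINT \<omega>:E|M. c)"
    using E(2) sets_F E(1) by (intro set_lebesgue_integral_cong) (auto simp: c_def p step_prob_def)
  also have "\<dots> = measure M E * c"
    using E(1) sets_F by (subst set_integral_const) auto
  finally have 1: "measure M {\<omega>\<in>E. X (Suc t) \<omega> \<in> B \<and> feedback (Suc t) \<omega> = p} = measure M E * c" .
  have "ennreal c = (\<integral>\<^sup>+x. ennreal (indicator B x * step_prob rstar \<psi> x p) \<partial>\<rho>)"
    unfolding c_def set_lebesgue_integral_def real_scaleR_def
    using int step_prob_bounds[of rstar \<psi>] by (intro nn_integral_eq_integral[symmetric]) auto
  also have "\<dots> = (\<integral>\<^sup>+x. ennreal (step_prob rstar \<psi> x p) * indicator B x \<partial>\<rho>)"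
    by (intro nn_integral_cong) (auto simp: indicator_def)
  finally show ?thesis
    by (simp add: M.emeasure_eq_measure 1 ennreal_mult')
qed

text \<open>Passage from sets B to functions g: two measures on contexts, the image of a restriction
  of \<open>M\<close> and a density over \<rho>, agree on all sets and hence have the same
  integrals.\<close>

lemma step_law_nn_integral:
  assumes E: "E \<in> sets (F t)" "E \<subseteq> {\<omega>\<in>space M. r (\<theta> t \<omega>) = \<psi>}" and \<psi>: "\<psi> \<in> r ` \<Theta>"
    and g [measurable]: "g \<in> borel_measurable \<rho>"
  shows "(\<integral>\<^sup>+\<omega>. indicator {\<omega>\<in>E. feedback (Suc t) \<omega> = p} \<omega> * g (X (Suc t) \<omega>) \<partial>M)
    = emeasure M E * (\<integral>\<^sup>+x. ennreal (step_prob rstar \<psi> x p) * g x \<partial>\<rho>)"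
proof -
  let ?D = "{\<omega>\<in>E. feedback (Suc t) \<omega> = p}"
  have [measurable]: "E \<in> sets M" using E sets_F by blast
  have D [measurable]: "?D \<in> sets M"
  proof -
    have "?D = E \<inter> {\<omega>\<in>space M. feedback (Suc t) \<omega> = p}" using E(2) by auto
    then show ?thesis by simp
  qed
  note [measurable] = step_prob_borel[OF class_borel[OF \<psi>] class_borel[OF rstar_class]]
  let ?N1 = "distr (density M (indicator ?D)) \<rho> (X (Suc t))"
  let ?N2 = "density \<rho> (\<lambda>x. emeasure M E * ennreal (step_prob rstar \<psi> x p))"
  have "?N1 = ?N2"
  proof (rule measure_eqI)
    fix B assume "B \<in> sets ?N1"
    then have B [measurable]: "B \<in> sets \<rho>" by simp
    have "emeasure ?N1 B = (\<integral>\<^sup>+\<omega>. indicator ?D \<omega> * indicator (X (Suc t) -` B \<inter> space M) \<omega> \<partial>M)"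
      by (simp add: emeasure_distr emeasure_density)
    also have "\<dots> = (\<integral>\<^sup>+\<omega>. indicator {\<omega>\<in>E. X (Suc t) \<omega> \<in> B \<and> feedback (Suc t) \<omega> = p} \<omega> \<partial>M)"
      by (intro nn_integral_cong) (auto simp: indicator_def)
    also have "\<dots> = emeasure M {\<omega>\<in>E. X (Suc t) \<omega> \<in> B \<and> feedback (Suc t) \<omega> = p}"
    proof (rule nn_integral_indicator)
      have "{\<omega>\<in>E. X (Suc t) \<omega> \<in> B \<and> feedback (Suc t) \<omega> = p} = ?D \<inter> (X (Suc t) -` B \<inter> space M)"
        using E(2) by auto
      then show "{\<omega>\<in>E. X (Suc t) \<omega> \<in> B \<and> feedback (Suc t) \<omega> = p} \<in> sets M" by simp
    qed
    also have "\<dots> = emeasure ?N2 B"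
      unfolding step_law[OF E \<psi> B] by (simp add: emeasure_density nn_integral_cmult mult.assoc)
    finally show "emeasure ?N1 B = emeasure ?N2 B" .
  qed simp
  then have "integral\<^sup>N ?N1 g = integral\<^sup>N ?N2 g" by simp
  then show ?thesis
    by (simp add: nn_integral_distr nn_integral_density nn_integral_cmult mult.assoc)
qed

text \<open>Plays the part of pulling a factor known after round t out of a conditional expectation:
  the same equality of measures, now extended from events of \<open>F t\<close> to
  \<open>F t\<close>-measurable functions.\<close>

lemma step_law_product:
  assumes S [measurable]: "S \<in> borel_measurable (F t)" and \<psi>: "\<psi> \<in> r ` \<Theta>"
    and g [measurable]: "g \<in> borel_measurable \<rho>"
  shows "(\<integral>\<^sup>+\<omega>. indicator {\<omega>\<in>space M. r (\<theta> t \<omega>) = \<psi>} \<omega> * indicator {\<omega>\<in>space M. feedback (Suc t) \<omega> = p} \<omega>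
            * g (X (Suc t) \<omega>) * S \<omega> \<partial>M)
    = (\<integral>\<^sup>+x. ennreal (step_prob rstar \<psi> x p) * g x \<partial>\<rho>)
        * (\<integral>\<^sup>+\<omega>. indicator {\<omega>\<in>space M. r (\<theta> t \<omega>) = \<psi>} \<omega> * S \<omega> \<partial>M)"
proof -
  let ?P = "{\<omega>\<in>space M. r (\<theta> t \<omega>) = \<psi>}" and ?Q = "{\<omega>\<in>space M. feedback (Suc t) \<omega> = p}"
  let ?g = "\<lambda>\<omega>. indicator ?P \<omega> * indicator ?Q \<omega> * g (X (Suc t) \<omega>)"
  define K where "K = (\<integral>\<^sup>+x. ennreal (step_prob rstar \<psi> x p) * g x \<partial>\<rho>)"
  have PF: "?P \<in> sets (F t)" using \<theta>_event[of t "{\<psi>}"] by simp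
  then have [measurable]: "?P \<in> sets M" using sets_F by blast
  have SM [measurable]: "S \<in> borel_measurable M" using S by (rule measurable_F_M)
  have id [measurable]: "(\<lambda>\<omega>. \<omega>) \<in> M \<rightarrow>\<^sub>M F t"
    using sets_F[of t] space_F[of t] by (auto simp: measurable_def sets.sets_into_space dest: subsetD)
  \<comment> \<open>The identity map into \<open>F t\<close> restricts both measures to the smaller
    sigma-algebra, so only events E of \<open>F t\<close> need to be compared.\<close>
  let ?N1 = "distr (density M ?g) (F t) (\<lambda>\<omega>. \<omega>)"
  let ?N2 = "distr (density M (\<lambda>\<omega>. K * indicator ?P \<omega>)) (F t) (\<lambda>\<omega>. \<omega>)"
  have "?N1 = ?N2"
  proof (rule measure_eqI)
    fix E assume "E \<in> sets ?N1"
    then have E [measurable]: "E \<in> sets (F t)" by simp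
    then have EM [measurable]: "E \<in> sets M" using sets_F by blast
    have sub: "E \<subseteq> space M" using EM by (rule sets.sets_into_space)
    have vim: "(\<lambda>\<omega>. \<omega>) -` E \<inter> space M = E" using sub by auto
    have EP: "E \<inter> ?P \<in> sets (F t)" using E PF by blast
    have "emeasure ?N1 E = (\<integral>\<^sup>+\<omega>. ?g \<omega> * indicator E \<omega> \<partial>M)"
      by (simp add: emeasure_distr emeasure_density vim)
    also have "\<dots> = (\<integral>\<^sup>+\<omega>. indicator {\<omega>\<in>E \<inter> ?P. feedback (Suc t) \<omega> = p} \<omega> * g (X (Suc t) \<omega>) \<partial>M)"
      using sub by (intro nn_integral_cong) (auto simp: indicator_def)
    also have "\<dots> = emeasure M (E \<inter> ?P) * K"
      unfolding K_def by (rule step_law_nn_integral[OF EP _ \<psi> g]) auto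
    also have "\<dots> = (\<integral>\<^sup>+\<omega>. K * indicator (E \<inter> ?P) \<omega> \<partial>M)"
      by (simp add: nn_integral_cmult mult.commute)
    also have "\<dots> = (\<integral>\<^sup>+\<omega>. K * indicator ?P \<omega> * indicator E \<omega> \<partial>M)"
      by (intro nn_integral_cong) (auto simp: indicator_def)
    also have "\<dots> = emeasure ?N2 E"
      by (simp add: emeasure_distr emeasure_density vim)
    finally show "emeasure ?N1 E = emeasure ?N2 E" .
  qed simp
  then have "integral\<^sup>N ?N1 S = integral\<^sup>N ?N2 S" by simp
  then have "(\<integral>\<^sup>+\<omega>. ?g \<omega> * S \<omega> \<partial>M) = (\<integral>\<^sup>+\<omega>. K * indicator ?P \<omega> * S \<omega> \<partial>M)"
    by (simp add: nn_integral_distr nn_integral_density)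
  also have "\<dots> = K * (\<integral>\<^sup>+\<omega>. indicator ?P \<omega> * S \<omega> \<partial>M)"
    by (simp add: nn_integral_cmult mult.assoc)
  finally show ?thesis by (simp add: K_def)
qed

lemma sum_indicator_\<theta>:
  assumes "\<omega> \<in> space M"
  shows "(\<Sum>\<psi>\<in>r ` \<Theta>. indicator {\<omega>\<in>space M. r (\<theta> t \<omega>) = \<psi>} \<omega> * c) = (c :: ennreal)"
proof -
  have "r (\<theta> t \<omega>) \<in> r ` \<Theta>" using measurable_space[OF \<theta>_measurable, of \<omega> t] assms by (simp add: space_F)
  moreover have "indicator {\<omega>\<in>space M. r (\<theta> t \<omega>) = \<psi>} \<omega> * c = (if \<psi> = r (\<theta> t \<omega>) then c else 0)" for \<psi>
    using assms by (auto simp: indicator_def)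
  ultimately show ?thesis using finite_class by simp
qed

text \<open>The space is split by the finitely many values of the current reward and of the
  feedback. Each piece factorizes, and since q bounds the factor for every reward value the pieces
  recombine.\<close>

lemma one_step_bound:
  assumes S [measurable]: "S \<in> borel_measurable (F t)"
    and G [measurable]: "\<And>p. (\<lambda>x. G x p) \<in> borel_measurable \<rho>"
    and q: "\<And>\<psi>. \<psi> \<in> r ` \<Theta> \<Longrightarrow> (\<integral>\<^sup>+x. (\<Sum>p\<in>UNIV. ennreal (step_prob rstar \<psi> x p) * G x p) \<partial>\<rho>) \<le> q"
  shows "(\<integral>\<^sup>+\<omega>. G (X (Suc t) \<omega>) (feedback (Suc t) \<omega>) * S \<omega> \<partial>M) \<le> q * (\<integral>\<^sup>+\<omega>. S \<omega> \<partial>M)"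
proof -
  let ?P = "\<lambda>\<psi>. {\<omega>\<in>space M. r (\<theta> t \<omega>) = \<psi>}" and ?Q = "\<lambda>p. {\<omega>\<in>space M. feedback (Suc t) \<omega> = p}"
  let ?I = "\<lambda>\<psi>. \<integral>\<^sup>+\<omega>. indicator (?P \<psi>) \<omega> * S \<omega> \<partial>M"
  have [measurable]: "?P \<psi> \<in> sets M" for \<psi> using \<theta>_event[of t "{\<psi>}"] sets_F by auto
  have SM [measurable]: "S \<in> borel_measurable M" using S by (rule measurable_F_M)
  have "(\<integral>\<^sup>+\<omega>. G (X (Suc t) \<omega>) (feedback (Suc t) \<omega>) * S \<omega> \<partial>M)
      = (\<integral>\<^sup>+\<omega>. (\<Sum>\<psi>\<in>r ` \<Theta>. \<Sum>p\<in>UNIV. indicator (?P \<psi>) \<omega> * indicator (?Q p) \<omega> * G (X (Suc t) \<omega>) p * S \<omega>) \<partial>M)"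
  proof (intro nn_integral_cong)
    fix \<omega> assume \<omega>: "\<omega> \<in> space M"
    have "(\<Sum>p\<in>UNIV. indicator (?Q p) \<omega> * (G (X (Suc t) \<omega>) p * S \<omega>))
        = (\<Sum>p\<in>UNIV. if feedback (Suc t) \<omega> = p then G (X (Suc t) \<omega>) p * S \<omega> else 0)"
      using \<omega> by (intro sum.cong) (auto simp: indicator_def)
    also have "\<dots> = G (X (Suc t) \<omega>) (feedback (Suc t) \<omega>) * S \<omega>" by simp
    finally show "G (X (Suc t) \<omega>) (feedback (Suc t) \<omega>) * S \<omega>
        = (\<Sum>\<psi>\<in>r ` \<Theta>. \<Sum>p\<in>UNIV. indicator (?P \<psi>) \<omega> * indicator (?Q p) \<omega> * G (X (Suc t) \<omega>) p * S \<omega>)"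
      using sum_indicator_\<theta>[OF \<omega>, of t "G (X (Suc t) \<omega>) (feedback (Suc t) \<omega>) * S \<omega>"]
      by (simp add: sum_distrib_left[symmetric] mult.assoc)
  qed
  also have "\<dots> = (\<Sum>\<psi>\<in>r ` \<Theta>. \<Sum>p\<in>UNIV. \<integral>\<^sup>+\<omega>. indicator (?P \<psi>) \<omega> * indicator (?Q p) \<omega> * G (X (Suc t) \<omega>) p * S \<omega> \<partial>M)"
    by (simp add: nn_integral_sum)
  also have "\<dots> = (\<Sum>\<psi>\<in>r ` \<Theta>. \<Sum>p\<in>UNIV. (\<integral>\<^sup>+x. ennreal (step_prob rstar \<psi> x p) * G x p \<partial>\<rho>) * ?I \<psi>)"
    by (intro sum.cong refl step_law_product) auto
  also have "\<dots> = (\<Sum>\<psi>\<in>r ` \<Theta>. (\<integral>\<^sup>+x. (\<Sum>p\<in>UNIV. ennreal (step_prob rstar \<psi> x p) * G x p) \<partial>\<rho>) * ?I \<psi>)"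
  proof (intro sum.cong refl)
    fix \<psi> assume "\<psi> \<in> r ` \<Theta>"
    note [measurable] = step_prob_borel[OF class_borel[OF this] class_borel[OF rstar_class]]
    show "(\<Sum>p\<in>UNIV. (\<integral>\<^sup>+x. ennreal (step_prob rstar \<psi> x p) * G x p \<partial>\<rho>) * ?I \<psi>)
        = (\<integral>\<^sup>+x. (\<Sum>p\<in>UNIV. ennreal (step_prob rstar \<psi> x p) * G x p) \<partial>\<rho>) * ?I \<psi>"
      by (simp add: nn_integral_sum sum_distrib_right)
  qed
  also have "\<dots> \<le> (\<Sum>\<psi>\<in>r ` \<Theta>. q * ?I \<psi>)" by (intro sum_mono mult_right_mono q) auto
  also have "\<dots> = q * (\<integral>\<^sup>+\<omega>. (\<Sum>\<psi>\<in>r ` \<Theta>. indicator (?P \<psi>) \<omega> * S \<omega>) \<partial>M)"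
    by (simp add: nn_integral_sum sum_distrib_left)
  also have "(\<integral>\<^sup>+\<omega>. (\<Sum>\<psi>\<in>r ` \<Theta>. indicator (?P \<psi>) \<omega> * S \<omega>) \<partial>M) = (\<integral>\<^sup>+\<omega>. S \<omega> \<partial>M)"
    by (intro nn_integral_cong sum_indicator_\<theta>)
  finally show ?thesis .
qed

section \<open>Geometric decay of the misidentification probability\<close>

lemma \<theta>_event_M: "{\<omega>\<in>space M. r (\<theta> t \<omega>) \<in> S} \<in> sets M"
  by (rule subsetD[OF sets_F \<theta>_event])

lemma \<theta>_in: "\<omega> \<in> space M \<Longrightarrow> \<theta> t \<omega> \<in> \<Theta>"
  using run by (cases t) (auto simp: exploration_run_def is_arg_min_def)

text \<open>Provides the exponents of the tempered likelihood ratio: a positive multiple of the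
  weights lying strictly between 0 and 1, uniformly in the context.\<close>

lemma weight_scaling:
  assumes \<psi>: "\<psi> \<in> r ` \<Theta>" and K: "\<And>x. T_bar f \<eta> \<pi>0 \<psi> x \<le> K"
  obtains s where "s > 0" "\<And>x. 0 < s * weight f \<eta> \<pi>0 \<rho> \<psi> x" "\<And>x. s * weight f \<eta> \<pi>0 \<rho> \<psi> x < 1"
proof -
  interpret \<rho>: prob_space \<rho> by (rule contexts)
  let ?R = "raw_weight f \<eta> \<pi>0 \<psi>"
  define L where "L = (1 + exp 1) * K"
  have le: "?R x \<le> L" for x
  proof -
    have "?R x \<le> (1 + exp 1) * T_bar f \<eta> \<pi>0 \<psi> x" by (rule raw_weight_le) (use \<psi> reward_range in auto)
    also have "\<dots> \<le> L" unfolding L_def by (intro mult_left_mono K) (auto simp: add_pos_pos less_imp_le)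
    finally show ?thesis .
  qed
  note [measurable] = raw_weight_borel[OF class_borel[OF \<psi>]]
  have int: "integrable \<rho> ?R"
    by (rule \<rho>.integrable_const_bound[where B = L])
      (use le raw_weight_pos[of \<psi>] in \<open>auto simp: less_imp_le\<close>)
  have "integral\<^sup>L \<rho> ?R \<noteq> 0"
  proof
    assume "integral\<^sup>L \<rho> ?R = 0"
    then have "AE x in \<rho>. ?R x = 0"
      using integral_nonneg_eq_0_iff_AE[OF int] raw_weight_pos[of \<psi>] by (simp add: less_imp_le)
    then have "AE x in \<rho>. False"
      by eventually_elim (use raw_weight_pos[of \<psi>] in \<open>simp add: less_imp_neq[THEN not_sym]\<close>)
    then show False by simp
  qed
  then have pos: "integral\<^sup>L \<rho> ?R > 0"
    using Bochner_Integration.integral_nonneg[of \<rho> ?R, OF less_imp_le[OF raw_weight_pos[of \<psi>]]] by simp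
  have "L > 0" using le raw_weight_pos[of \<psi>] less_le_trans by blast
  \<comment> \<open>The integral cancels the normalizer of \<open>weight\<close>, leaving the raw
    weight over 2 L; the factor 2 makes the bound 1/2 and hence strictly below 1.\<close>
  let ?s = "integral\<^sup>L \<rho> ?R / (2 * L)"
  have eq: "?s * weight f \<eta> \<pi>0 \<rho> \<psi> x = ?R x / (2 * L)" for x
    using pos by (simp add: weight_def)
  show thesis
  proof (rule that[of ?s])
    show "?s > 0" using pos \<open>L > 0\<close> by simp
    show "0 < ?s * weight f \<eta> \<pi>0 \<rho> \<psi> x" for x
      unfolding eq using raw_weight_pos[of \<psi> x] \<open>L > 0\<close> by simp
    show "?s * weight f \<eta> \<pi>0 \<rho> \<psi> x < 1" for x
      unfolding eq using le[of x] \<open>L > 0\<close> by simp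
  qed
qed

text \<open>The loss at the minimizer is at most the loss at \<open>\<theta>star\<close>.
  Multiplying the difference by s times the number of rounds and exponentiating turns it into the
  product of tempered ratios.\<close>

lemma minimizer_tilt_ge_1:
  assumes \<omega>: "\<omega> \<in> space M" and s: "s > 0"
    and \<tau>: "\<And>x. \<tau> x = s * weight f \<eta> \<pi>0 \<rho> (r (\<theta> t \<omega>)) x"
  shows "1 \<le> (\<Prod>i=1..Suc t. tilt \<tau> (r (\<theta> (Suc t) \<omega>)) rstar (X i \<omega>) (feedback i \<omega>))"
proof -
  let ?w = "weight f \<eta> \<pi>0 \<rho> (r (\<theta> t \<omega>))" and ?\<phi> = "r (\<theta> (Suc t) \<omega>)"
  let ?ll = "\<lambda>u i. ?w (X i \<omega>) * ln (logistic (u (X i \<omega>) (winner (A1 i \<omega>) (A2 i \<omega>) (Y i \<omega>))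
                                        - u (X i \<omega>) (loser (A1 i \<omega>) (A2 i \<omega>) (Y i \<omega>))))"
  let ?nll = "weighted_nll ?w (Suc t) (\<lambda>i. X i \<omega>) (\<lambda>i. A1 i \<omega>) (\<lambda>i. A2 i \<omega>) (\<lambda>i. Y i \<omega>)"
  have "is_arg_min (\<lambda>\<phi>. ?nll (r \<phi>)) (\<lambda>\<phi>. \<phi> \<in> \<Theta>) (\<theta> (Suc t) \<omega>)"
    using run \<omega> unfolding exploration_run_def by blast
  then have "?nll ?\<phi> \<le> ?nll (r \<theta>star)"
    using realizable(1) by (auto simp: is_arg_min_def not_less)
  then have "?nll ?\<phi> \<le> ?nll rstar" by (simp add: realizable(2))
  then have "1 / real (Suc t) * (\<Sum>i=1..Suc t. ?ll rstar i) \<le> 1 / real (Suc t) * (\<Sum>i=1..Suc t. ?ll ?\<phi> i)"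
    unfolding weighted_nll_def by linarith
  then have "(\<Sum>i=1..Suc t. ?ll rstar i) \<le> (\<Sum>i=1..Suc t. ?ll ?\<phi> i)"
    by (subst (asm) mult_le_cancel_left_pos) auto
  then have "0 \<le> s * (\<Sum>i=1..Suc t. ?ll ?\<phi> i - ?ll rstar i)"
    using s by (simp add: sum_subtractf)
  also have "\<dots> = (\<Sum>i=1..Suc t. s * (?ll ?\<phi> i - ?ll rstar i))" by (rule sum_distrib_left)
  finally have "1 \<le> exp (\<Sum>i=1..Suc t. s * (?ll ?\<phi> i - ?ll rstar i))" by simp
  also have "\<dots> = (\<Prod>i=1..Suc t. exp (s * (?ll ?\<phi> i - ?ll rstar i)))" by (rule exp_sum) simp
  also have "\<dots> = (\<Prod>i=1..Suc t. tilt \<tau> ?\<phi> rstar (X i \<omega>) (feedback i \<omega>))"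
    by (intro prod.cong refl) (simp add: tilt_def feedback_def \<tau> algebra_simps)
  finally show ?thesis .
qed

text \<open>On the event the product of tempered ratios is at least 1, so its probability is at most
  the mean of the product. Fixing \<psi> makes the exponents deterministic and identical in all
  rounds, which permits the round-by-round bound.\<close>

lemma misidentification_geometric:
  assumes \<psi>: "\<psi> \<in> r ` \<Theta>" and K: "\<And>x. T_bar f \<eta> \<pi>0 \<psi> x \<le> K"
    and \<phi>: "\<phi> \<in> r ` \<Theta>" "\<not> same_gaps \<phi> rstar"
  shows "\<exists>q. 0 \<le> q \<and> q < 1 \<and>
    (\<forall>t. measure M {\<omega>\<in>space M. r (\<theta> t \<omega>) = \<psi> \<and> r (\<theta> (Suc t) \<omega>) = \<phi>} \<le> q ^ Suc t)"
proof -
  obtain s where s: "s > 0" "\<And>x. 0 < s * weight f \<eta> \<pi>0 \<rho> \<psi> x" "\<And>x. s * weight f \<eta> \<pi>0 \<rho> \<psi> x < 1"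
    using weight_scaling[OF \<psi> K] by blast
  define \<tau> where "\<tau> x = s * weight f \<eta> \<pi>0 \<rho> \<psi> x" for x
  note [measurable] = raw_weight_borel[OF class_borel[OF \<psi>]]
  have \<tau>_borel: "\<tau> \<in> borel_measurable \<rho>" unfolding \<tau>_def[abs_def] weight_def by measurable
  define G where "G x p = ennreal (tilt \<tau> \<phi> rstar x p)" for x p
  have tilt_borel': "(\<lambda>x. tilt \<tau> \<phi> rstar x p) \<in> borel_measurable \<rho>" for p
    by (intro tilt_borel \<tau>_borel class_borel \<phi> rstar_class)
  then have G_borel: "(\<lambda>x. G x p) \<in> borel_measurable \<rho>" for p
    unfolding G_def by simp
  have tilt_pos: "tilt \<tau> \<phi> rstar x p > 0" for x p by (simp add: tilt_def split: prod.split)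
  define I where "I \<psi>' = (\<integral>\<^sup>+x. ennreal (\<Sum>p\<in>UNIV. step_prob rstar \<psi>' x p * tilt \<tau> \<phi> rstar x p) \<partial>\<rho>)" for \<psi>'
  \<comment> \<open>Only the last round is known to be sampled at \<psi>; earlier rounds may use any
    reward of the class. The maximum of the one-round factors covers them all, and being taken over
    a finite set it stays below 1.\<close>
  define q where "q = Max (I ` r ` \<Theta>)"
  have "I \<psi>' < 1" if "\<psi>' \<in> r ` \<Theta>" for \<psi>'
    unfolding I_def using s \<phi>
    by (intro tilted_step_integral_less_1 \<tau>_borel class_borel that rstar_class) (auto simp: \<tau>_def)
  then have q_less: "q < 1" unfolding q_def using finite_class \<psi> by (subst Max_less_iff) auto
  define S where "S t \<omega> = (\<Prod>i=1..t. G (X i \<omega>) (feedback i \<omega>))" for t \<omega>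
  have S_borel: "S t \<in> borel_measurable (F t)" for t
  proof -
    have "(\<lambda>\<omega>. G (X i \<omega>) (feedback i \<omega>)) \<in> borel_measurable (F t)" if "i \<in> {1..t}" for i
    proof (rule measurable_compose_countable[of "\<lambda>p \<omega>. G (X i \<omega>) p"])
      show "(\<lambda>\<omega>. G (X i \<omega>) p) \<in> borel_measurable (F t)" for p
        by (rule measurable_compose[OF measurable_F_le[OF X_measurable] G_borel]) (use that in auto)
      show "feedback i \<in> F t \<rightarrow>\<^sub>M count_space UNIV"
        by (rule measurable_F_le[OF feedback_measurable]) (use that in auto)
    qed
    then show ?thesis unfolding S_def[abs_def] by (rule borel_measurable_prod_ennreal)
  qed
  have S_bound: "(\<integral>\<^sup>+\<omega>. S t \<omega> \<partial>M) \<le> q ^ t" for t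
  proof (induction t)
    case 0
    then show ?case by (simp add: S_def M.emeasure_space_1)
  next
    case (Suc t)
    have "(\<integral>\<^sup>+\<omega>. S (Suc t) \<omega> \<partial>M) = (\<integral>\<^sup>+\<omega>. G (X (Suc t) \<omega>) (feedback (Suc t) \<omega>) * S t \<omega> \<partial>M)"
      by (simp add: S_def mult.commute)
    also have "\<dots> \<le> q * (\<integral>\<^sup>+\<omega>. S t \<omega> \<partial>M)"
    proof (rule one_step_bound[OF S_borel G_borel])
      fix \<psi>' assume \<psi>': "\<psi>' \<in> r ` \<Theta>"
      have "(\<integral>\<^sup>+x. (\<Sum>p\<in>UNIV. ennreal (step_prob rstar \<psi>' x p) * G x p) \<partial>\<rho>) = I \<psi>'"
        unfolding I_def G_def using step_prob_bounds(1)[of rstar \<psi>'] tilt_pos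
        by (intro nn_integral_cong) (simp add: ennreal_mult[symmetric] less_imp_le)
      then show "(\<integral>\<^sup>+x. (\<Sum>p\<in>UNIV. ennreal (step_prob rstar \<psi>' x p) * G x p) \<partial>\<rho>) \<le> q"
        unfolding q_def using finite_class \<psi>' by simp
    qed
    also have "\<dots> \<le> q * q ^ t" by (rule mult_left_mono[OF Suc.IH]) simp
    finally show ?case by simp
  qed
  obtain q' where q': "q' \<ge> 0" "q = ennreal q'" using q_less by (cases q) auto
  have "measure M {\<omega>\<in>space M. r (\<theta> t \<omega>) = \<psi> \<and> r (\<theta> (Suc t) \<omega>) = \<phi>} \<le> q' ^ Suc t" for t
  proof -
    let ?E = "{\<omega>\<in>space M. r (\<theta> t \<omega>) = \<psi> \<and> r (\<theta> (Suc t) \<omega>) = \<phi>}"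
    have "?E = {\<omega>\<in>space M. r (\<theta> t \<omega>) \<in> {\<psi>}} \<inter> {\<omega>\<in>space M. r (\<theta> (Suc t) \<omega>) \<in> {\<phi>}}" by auto
    then have "?E \<in> sets M" by (simp only: sets.Int \<theta>_event_M)
    then have "emeasure M ?E = (\<integral>\<^sup>+\<omega>. indicator ?E \<omega> \<partial>M)" by simp
    also have "\<dots> \<le> (\<integral>\<^sup>+\<omega>. S (Suc t) \<omega> \<partial>M)"
    proof (intro nn_integral_mono)
      fix \<omega> assume \<omega>: "\<omega> \<in> space M"
      show "indicator ?E \<omega> \<le> S (Suc t) \<omega>"
      proof (cases "\<omega> \<in> ?E")
        case True
        then have "1 \<le> (\<Prod>i=1..Suc t. tilt \<tau> \<phi> rstar (X i \<omega>) (feedback i \<omega>))"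
          using minimizer_tilt_ge_1[OF \<omega> s(1), of \<tau> t] by (simp add: \<tau>_def)
        then have "ennreal 1 \<le> ennreal (\<Prod>i=1..Suc t. tilt \<tau> \<phi> rstar (X i \<omega>) (feedback i \<omega>))"
          by (rule ennreal_leI)
        also have "\<dots> = S (Suc t) \<omega>"
          unfolding S_def G_def using tilt_pos by (intro prod_ennreal[symmetric]) (simp add: less_imp_le)
        finally show ?thesis using True by simp
      qed simp
    qed
    also have "\<dots> \<le> q ^ Suc t" by (rule S_bound)
    also have "\<dots> = ennreal (q' ^ Suc t)" unfolding q' using q'(1) by (rule ennreal_power)
    finally show ?thesis unfolding measure_def using q'(1) by (intro enn2real_leI) auto
  qed
  then show ?thesis using q' q_less by (intro exI[of _ q']) (auto simp: ennreal_less_one_iff)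
qed

text \<open>A union bound over the finitely many pairs of consecutive rewards whose second member
  has the wrong gaps; each pair contributes its own geometric rate.\<close>

lemma misidentification_tendsto_0:
  assumes K: "\<And>\<psi> x. \<psi> \<in> r ` \<Theta> \<Longrightarrow> T_bar f \<eta> \<pi>0 \<psi> x \<le> K"
  shows "(\<lambda>t. measure M {\<omega>\<in>space M. \<not> same_gaps (r (\<theta> t \<omega>)) rstar}) \<longlonglongrightarrow> 0"
proof -
  let ?B = "{\<phi>\<in>r ` \<Theta>. \<not> same_gaps \<phi> rstar}"
  let ?I = "r ` \<Theta> \<times> ?B"
  let ?E = "\<lambda>t (\<psi>, \<phi>). {\<omega>\<in>space M. r (\<theta> t \<omega>) = \<psi> \<and> r (\<theta> (Suc t) \<omega>) = \<phi>}"
  have "\<forall>i\<in>?I. \<exists>q. 0 \<le> q \<and> q < 1 \<and> (\<forall>t. measure M (?E t i) \<le> q ^ Suc t)"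
  proof
    fix i assume i: "i \<in> ?I"
    have "\<exists>q. 0 \<le> q \<and> q < 1 \<and> (\<forall>t. measure M {\<omega>\<in>space M. r (\<theta> t \<omega>) = fst i \<and> r (\<theta> (Suc t) \<omega>) = snd i} \<le> q ^ Suc t)"
    proof (rule misidentification_geometric)
      have *: "fst i \<in> r ` \<Theta> \<and> snd i \<in> ?B" using i unfolding mem_Times_iff .
      from * show \<psi>: "fst i \<in> r ` \<Theta>" by (rule conjunct1)
      from * show "snd i \<in> r ` \<Theta>" "\<not> same_gaps (snd i) rstar" by simp_all
      show "T_bar f \<eta> \<pi>0 (fst i) x \<le> K" for x by (rule K[OF \<psi>])
    qed
    then show "\<exists>q. 0 \<le> q \<and> q < 1 \<and> (\<forall>t. measure M (?E t i) \<le> q ^ Suc t)"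
      by (simp add: case_prod_beta)
  qed
  from bchoice[OF this] obtain q where
    "\<forall>i\<in>?I. 0 \<le> q i \<and> q i < 1 \<and> (\<forall>t. measure M (?E t i) \<le> q i ^ Suc t)"
    by (rule exE)
  then have q: "0 \<le> q i" "q i < 1" "measure M (?E t i) \<le> q i ^ Suc t" if "i \<in> ?I" for i t
    using that by (simp_all only:)
  have fin: "finite ?I" using finite_class by simp
  have bound: "measure M {\<omega>\<in>space M. \<not> same_gaps (r (\<theta> (Suc t) \<omega>)) rstar} \<le> (\<Sum>i\<in>?I. q i ^ Suc t)" for t
  proof -
    have E: "?E t i \<in> sets M" for i
    proof -
      have "?E t i = {\<omega>\<in>space M. r (\<theta> t \<omega>) \<in> {fst i}} \<inter> {\<omega>\<in>space M. r (\<theta> (Suc t) \<omega>) \<in> {snd i}}"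
        by (cases i) auto
      then show ?thesis by (simp only: sets.Int \<theta>_event_M)
    qed
    have "{\<omega>\<in>space M. \<not> same_gaps (r (\<theta> (Suc t) \<omega>)) rstar} = (\<Union>i\<in>?I. ?E t i)"
      using \<theta>_in by auto
    then have "measure M {\<omega>\<in>space M. \<not> same_gaps (r (\<theta> (Suc t) \<omega>)) rstar} \<le> (\<Sum>i\<in>?I. measure M (?E t i))"
      using M.finite_measure_subadditive_finite[OF fin, of "?E t"] image_subsetI[of ?I "?E t" "sets M"] E by (simp only:)
    also have "\<dots> \<le> (\<Sum>i\<in>?I. q i ^ Suc t)" by (intro sum_mono q(3))
    finally show ?thesis .
  qed
  have lim: "(\<lambda>t. \<Sum>i\<in>?I. q i ^ Suc t) \<longlonglongrightarrow> 0"
  proof (rule tendsto_null_sum)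
    fix i assume "i \<in> ?I"
    then show "(\<lambda>t. q i ^ Suc t) \<longlonglongrightarrow> 0"
      using q by (intro LIMSEQ_Suc LIMSEQ_realpow_zero) auto
  qed
  have "(\<lambda>t. measure M {\<omega>\<in>space M. \<not> same_gaps (r (\<theta> (Suc t) \<omega>)) rstar}) \<longlonglongrightarrow> 0"
    by (rule tendsto_sandwich[OF _ _ tendsto_const lim]) (use bound in \<open>auto intro: always_eventually\<close>)
  \<comment> \<open>The estimate starts at round 1, since the initial parameter minimizes no loss;
    the shift leaves the limit unchanged.\<close>
  then show ?thesis by (rule LIMSEQ_imp_Suc)
qed

section \<open>The constant of the bound and the vanishing of the gap\<close>

lemma T_bar_le_M_const:
  assumes "\<psi> \<in> r ` \<Theta>" shows "ereal (T_bar f \<eta> \<pi>0 \<psi> x) \<le> M_const f (r ` \<Theta>) \<eta> \<pi>0"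
proof -
  have "\<psi> \<in> reward_hull (r ` \<Theta>)"
    unfolding reward_hull_def using assms by (intro CollectI exI[of _ "{\<psi>}"] exI[of _ "\<lambda>_. 1"]) auto
  then show ?thesis
    unfolding M_const_def T_bar_def[symmetric] by (intro SUP_upper2[of \<psi>] SUP_upper) auto
qed

context
  fixes C :: real
  assumes C: "C \<ge> 1"
begin

abbreviation "C0 \<equiv> C0_const f (r ` \<Theta>) \<eta> \<pi>0 C (r \<theta>star)"

text \<open>All three factors are positive, so no product of 0 and infinity occurs: an infinite
  \<open>M_const\<close> would make the whole constant infinite.\<close>

lemma C0_pos: "C0 > 0" and M_const_finite: "C0 \<noteq> \<infinity> \<Longrightarrow> M_const f (r ` \<Theta>) \<eta> \<pi>0 \<noteq> \<infinity>"
proof -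
  let ?g = "\<lambda>x. T_bar f \<eta> \<pi>0 (r \<theta>star) x
    + T_bar f \<eta> \<pi>0 (r \<theta>star) x * Z_plus f \<eta> \<pi>0 (r \<theta>star) x * Z_minus f \<eta> \<pi>0 (r \<theta>star) x"
  \<comment> \<open>Types are inhabited, so a single arbitrary context bounds both suprema away from
    0.\<close>
  fix x :: 'x
  have "?g x > 0" by (intro add_pos_pos mult_pos_pos T_bar_pos Z_plus_pos Z_minus_pos)
  then have "0 < ereal \<bar>?g x\<bar>" by simp
  also have "\<dots> \<le> sup_norm ?g" unfolding sup_norm_def by (rule SUP_upper) simp
  finally have sup: "sup_norm ?g > 0" .
  have "0 < ereal (T_bar f \<eta> \<pi>0 (r \<theta>star) x)" using T_bar_pos by simp
  also have "\<dots> \<le> M_const f (r ` \<Theta>) \<eta> \<pi>0" by (rule T_bar_le_M_const) (use realizable in auto)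
  finally have M: "M_const f (r ` \<Theta>) \<eta> \<pi>0 > 0" .
  have c: "2 * \<eta> * C > 0" using eta C by simp
  show "C0 > 0"
    unfolding C0_const_def using sup M c by (simp add: ereal_zero_less_0_iff)
  show "M_const f (r ` \<Theta>) \<eta> \<pi>0 \<noteq> \<infinity>" if "C0 \<noteq> \<infinity>"
  proof
    assume "M_const f (r ` \<Theta>) \<eta> \<pi>0 = \<infinity>"
    then have "C0 = \<infinity>" unfolding C0_const_def using eta C sup by simp
    with that show False by simp
  qed
qed

text \<open>The threshold is positive, so crossing it requires a nonzero gap and hence wrong reward
  differences. An infinite threshold cannot be reached by a difference of finite objectives.\<close>

lemma large_gap_tendsto_0:
  assumes "k > 0"
  shows "(\<lambda>T. measure M {\<omega> \<in> space M.
             J_obj f \<eta> \<pi>0 \<rho> rstar (opt_policy f \<eta> \<pi>0 \<rho> rstar)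
               - J_obj f \<eta> \<pi>0 \<rho> rstar (reward_policy f \<eta> \<pi>0 (r (\<theta> T \<omega>))) \<ge> C0 * ereal (k / real T)}) \<longlonglongrightarrow> 0"
proof -
  let ?J = "\<lambda>\<psi>. J_obj f \<eta> \<pi>0 \<rho> rstar (reward_policy f \<eta> \<pi>0 \<psi>)"
  let ?E = "\<lambda>T. {\<omega> \<in> space M. J_obj f \<eta> \<pi>0 \<rho> rstar (opt_policy f \<eta> \<pi>0 \<rho> rstar) - ?J (r (\<theta> T \<omega>)) \<ge> C0 * ereal (k / real T)}"
  let ?B = "\<lambda>T. {\<omega>\<in>space M. \<not> same_gaps (r (\<theta> T \<omega>)) rstar}"
  have rstar_range: "rstar x a \<in> {0..1}" for x a using reward_range[OF realizable(1)] realizable(2) by simp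
  have fin: "\<bar>?J \<psi>\<bar> \<noteq> \<infinity>" if "\<psi> \<in> r ` \<Theta>" for \<psi>
    by (rule J_obj_finite) (use that reward_range rstar_range in auto)
  have opt: "J_obj f \<eta> \<pi>0 \<rho> rstar (opt_policy f \<eta> \<pi>0 \<rho> rstar) = ?J rstar"
    by (rule J_obj_opt_policy[OF class_borel[OF rstar_class]])
  \<comment> \<open>The case T = 0 is excluded because there \<open>k / real T\<close> is 0, which
    makes the threshold 0 even for an infinite constant.\<close>
  have sub: "?E T \<subseteq> ?B T" "C0 = \<infinity> \<Longrightarrow> ?E T = {}" if "T \<ge> 1" for T
  proof -
    have pos: "k / real T > 0" using that assms by simp
    show "?E T \<subseteq> ?B T"
    proof safe
      fix \<omega> assume \<omega>: "\<omega> \<in> space M" "C0 * ereal (k / real T) \<le> J_obj f \<eta> \<pi>0 \<rho> rstar (opt_policy f \<eta> \<pi>0 \<rho> rstar) - ?J (r (\<theta> T \<omega>))"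
        and "same_gaps (r (\<theta> T \<omega>)) rstar"
      then have "C0 * ereal (k / real T) \<le> ?J rstar - ?J rstar"
        using J_obj_same_gaps[of "r (\<theta> T \<omega>)" rstar] opt by simp
      \<comment> \<open>Finiteness matters here: in the extended reals a value minus itself is 0
        only if the value is finite.\<close>
      also have "\<dots> = 0" using fin[OF rstar_class] by (cases "?J rstar") (auto simp: zero_ereal_def)
      finally have "C0 * ereal (k / real T) \<le> 0" .
      moreover have "0 < C0 * ereal (k / real T)" unfolding ereal_zero_less_0_iff using C0_pos pos by simp
      ultimately show False by (simp add: leD)
    qed
    show "?E T = {}" if "C0 = \<infinity>"
    proof safe
      fix \<omega> assume \<omega>: "\<omega> \<in> space M" "C0 * ereal (k / real T) \<le> J_obj f \<eta> \<pi>0 \<rho> rstar (opt_policy f \<eta> \<pi>0 \<rho> rstar) - ?J (r (\<theta> T \<omega>))"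
      have "C0 * ereal (k / real T) = \<infinity>" unfolding that using that assms \<open>T \<ge> 1\<close> by simp
      from \<omega>(2)[unfolded opt this] have "?J rstar - ?J (r (\<theta> T \<omega>)) = \<infinity>"
        by (rule ereal_infty_less_eq(1)[THEN iffD1])
      moreover have "\<bar>?J (r (\<theta> T \<omega>))\<bar> \<noteq> \<infinity>" by (rule fin[OF imageI[OF \<theta>_in[OF \<omega>(1)]]])
      ultimately show "\<omega> \<in> {}"
        using fin[OF rstar_class] by (cases "?J rstar"; cases "?J (r (\<theta> T \<omega>))") auto
    qed
  qed
  show ?thesis
  proof (cases "C0 = \<infinity>")
    case True
    have "eventually (\<lambda>T. measure M (?E T) = 0) sequentially"
      using eventually_ge_at_top[of 1] by eventually_elim (simp add: sub(2)[OF _ True])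
    then show ?thesis by (rule tendsto_eventually)
  next
    case False
    then have "M_const f (r ` \<Theta>) \<eta> \<pi>0 \<noteq> \<infinity>" by (rule M_const_finite)
    moreover have "M_const f (r ` \<Theta>) \<eta> \<pi>0 \<noteq> - \<infinity>"
      using T_bar_le_M_const[OF rstar_class] by auto
    ultimately obtain K where "M_const f (r ` \<Theta>) \<eta> \<pi>0 = ereal K"
      by (cases "M_const f (r ` \<Theta>) \<eta> \<pi>0") auto
    then have "T_bar f \<eta> \<pi>0 \<psi> x \<le> K" if "\<psi> \<in> r ` \<Theta>" for \<psi> x
      using T_bar_le_M_const[OF that, of x] by simp
    from misidentification_tendsto_0[OF this] have lim: "(\<lambda>T. measure M (?B T)) \<longlonglongrightarrow> 0" .
    have "?B T \<in> sets M" for T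
      using \<theta>_event_M[of T "{\<psi>. \<not> same_gaps \<psi> rstar}"] by simp
    then have "measure M (?E T) \<le> measure M (?B T)" if "T \<ge> 1" for T
      by (intro M.finite_measure_mono sub(1) that)
    then have "eventually (\<lambda>T. measure M (?E T) \<le> measure M (?B T)) sequentially"
      by (rule eventually_sequentiallyI)
    then show ?thesis
      by (rule tendsto_sandwich[OF always_eventually[OF allI[OF measure_nonneg]] _ tendsto_const lim])
  qed
qed

end

end

theorem proposition4p4:
  fixes f :: "real \<Rightarrow> real" and \<eta> C \<epsilon> :: real
    and \<rho> :: "'x measure"
    and \<pi>0 rstar :: "'x \<Rightarrow> 'a::finite \<Rightarrow> real"
    and \<Theta> :: "(real ^ 'd) set" and r :: "real ^ 'd \<Rightarrow> 'x \<Rightarrow> 'a \<Rightarrow> real" and \<theta>star :: "real ^ 'd"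
    and M :: "'w measure" and F :: "nat \<Rightarrow> 'w measure"
    and X :: "nat \<Rightarrow> 'w \<Rightarrow> 'x" and A1 A2 :: "nat \<Rightarrow> 'w \<Rightarrow> 'a" and Y :: "nat \<Rightarrow> 'w \<Rightarrow> bool"
    and \<theta> :: "nat \<Rightarrow> 'w \<Rightarrow> real ^ 'd"
  assumes contexts: "prob_space \<rho>" "space \<rho> = UNIV"
    and eta: "\<eta> > 0"
    and generator: "divergence_generator f"
    and f'_invertible: "inj_on (deriv f) {0<..}"
    and zero_notin_dom_f': "filterlim (deriv f) at_bot (at_right 0)"
    and reference: "policy \<rho> \<pi>0" "\<And>x a. \<pi>0 x a > 0"
    and reward_meas: "\<And>\<phi> a. \<phi> \<in> \<Theta> \<Longrightarrow> (\<lambda>x. r \<phi> x a) \<in> borel_measurable \<rho>"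
    and reward_range: "\<And>\<phi> x a. \<phi> \<in> \<Theta> \<Longrightarrow> r \<phi> x a \<in> {0..1}" "\<And>x a. rstar x a \<in> {0..1}"
    and finite_class: "finite (r ` \<Theta>)"
    and realizable: "\<theta>star \<in> \<Theta>" "r \<theta>star = rstar"
    and C_ge_1: "C \<ge> 1"
    and C_bound: "\<And>\<phi> x a1 a2. \<phi> \<in> \<Theta> \<Longrightarrow>
          logistic (r \<phi> x a1 - r \<phi> x a2) * logistic (r \<phi> x a2 - r \<phi> x a1)
            \<le> C * (logistic (rstar x a1 - rstar x a2) * logistic (rstar x a2 - rstar x a1))"
    and run: "exploration_run f \<eta> \<pi>0 \<rho> \<Theta> r rstar M F X A1 A2 Y \<theta>"
    and eps: "\<epsilon> > 0"
  shows "limsup (\<lambda>T. ereal (measure M {\<omega> \<in> space M.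
             J_obj f \<eta> \<pi>0 \<rho> rstar (opt_policy f \<eta> \<pi>0 \<rho> rstar)
               - J_obj f \<eta> \<pi>0 \<rho> rstar (reward_policy f \<eta> \<pi>0 (r (\<theta> T \<omega>)))
             \<ge> C0_const f (r ` \<Theta>) \<eta> \<pi>0 C (r \<theta>star) * ereal (real CARD('d) * (1 + \<epsilon>) / real T)}))
           \<le> ereal (measure (chi_square CARD('d)) {z. z \<ge> real CARD('d) * (1 + \<epsilon>)})
       \<and> measure (chi_square CARD('d)) {z. z \<ge> real CARD('d) * (1 + \<epsilon>)}
           \<le> exp (- (real CARD('d) / 2) * (\<epsilon> - ln (1 + \<epsilon>)))"
proof -
  interpret exploration f \<eta> \<pi>0 \<rho> \<Theta> r rstar \<theta>star M F X A1 A2 Y \<theta>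
    by (intro exploration.intro regular_reference.intro regular_generator.intro
        regular_reference_axioms.intro exploration_axioms.intro; fact)
  have "real CARD('d) * (1 + \<epsilon>) > 0" using eps by simp
  \<comment> \<open>Convergence of the probabilities makes the limsup 0, which lies below the
    chi-squared tail because a measure is nonnegative.\<close>
  note lim_imp_Limsup[OF trivial_limit_sequentially tendsto_ereal[OF large_gap_tendsto_0[OF C_ge_1 this]]]
  then show ?thesis
    using chi_square_tail[OF eps, of "CARD('d)"] by (simp only: ereal_less_eq measure_nonneg simp_thms)
qed

end
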